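(* Let $V$ be a commutative, unital, integral, non-trivial quantale whose underlying lattice is a frame. Let $(X,a)$ be a $V$-group. Let $Y=\mathbb Z\times X$ (product group), let $b:Y\times Y\to V$ be given by \[b((z,x),(z',x'))=\begin{cases}a(x,x') & \text{if } z<z',\\ \top & \text{if } z=z' \text{ and } x=x',\\ \bot & \text{otherwise,}\end{cases}\] and let $f:(Y,b)\to(X,a)$ be the effective descent morphism $f(z,x)=x$ in $V\text{-}\mathsf{Grp}$. Then there exists an equivalence of categories \[\mathcal M^*\downarrow(X,a)\;\simeq\; V\text{-}\mathsf{Grp}_{\mathsf{sep}}^{\,Eq(f)},\] where $\mathcal M^*\downarrow(X,a)$ is the category of coverings over $(X,a)$ and $V\text{-}\mathsf{Grp}_{\mathsf{sep}}^{\,Eq(f)}$ is the category of internal $Eq(f)$-actions in $V\text{-}\mathsf{Grp}$ whose underlying object is a separated $V$-group.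
   Context: Quantales. A commutative unital quantale $V$ is a complete lattice (bottom $\bot$, top $\top$) with an associative, commutative operation $\otimes$ with unit $k$, preserving arbitrary joins in each variable (in particular $v\otimes\bot=\bot$). $V$ is non-trivial if $\bot\neq\top$, integral if $k=\top$. It is assumed that $V$ is a frame, i.e. arbitrary joins distribute over finite meets. $V$-groups. A $V$-relation $a$ on a set $X$ is a function $a:X\times X\to V$. A $V$-category is a pair $(X,a)$ with $k\le a(x,x)$ and $a(x,x')\otimes a(x',x'')\le a(x,x'')$ for all $x,x',x''\in X$. A $V$-group is a $V$-category $(X,a)$ with a (not necessarily abelian) group structure $(X,+,-,0)$ such that $a(x_1,x_2)\otimes a(x_1',x_2')\le a(x_1+x_1',x_2+x_2')$ for all elements of $X$; equivalently, a $V$-category with a group structure such that $a(x',x'')=a(x'+x,x''+x)$ for all $x,x',x''$. A $V$-homomorphism $f:(X,a)\to(Y,b)$ is a group homomorphism with $a(x,x')\le b(f(x),f(x'))$ for all $x,x'\in X$. $V$-groups and $V$-homomorphisms form the category $V\text{-}\mathsf{Grp}$. Pullbacks in $V\text{-}\mathsf{Grp}$ are pullbacks of groups with the $V$-relation given by the pointwise meet of the two structures. A $V$-group $(X,a)$ is separated if $a(x,x')\ge k$ and $a(x',x)\ge k$ imply $x=x'$; $V\text{-}\mathsf{Grp}_{\mathsf{sep}}$ is the full subcategory of separated $V$-groups. The inclusion $U:V\text{-}\mathsf{Grp}_{\mathsf{sep}}\to V\text{-}\mathsf{Grp}$ has a left adjoint $F$ with $F(X,a)=(X/N_X,\bar a)$,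 where $N_X=\{x\in X\mid a(0,x)\ge k \text{ and } a(x,0)\ge k\}$ (a normal subgroup), the unit component $\eta_X:X\to X/N_X$ is the quotient map and $\bar a(z_1,z_2)=\bigvee_{\eta_X(x_i)=z_i}a(x_1,x_2)$. Coverings. A morphism $p:E\to B$ is an effective descent morphism if the pullback functor between slice categories over $B$ and over $E$ is monadic; in $V\text{-}\mathsf{Grp}$ these are known to be exactly the regular epimorphisms. A trivial covering is a morphism $g:(Z,c)\to(X,a)$ in $V\text{-}\mathsf{Grp}$ whose naturality square $UF(g)\cdot\eta_Z=\eta_X\cdot g$ is a pullback. A covering is a morphism $g:(Z,c)\to(X,a)$ such that $p^*(g)$ (the pullback of $g$ along $p$) is a trivial covering for some effective descent morphism $p$ with codomain $(X,a)$. $\mathcal M^*$ is the class of coverings, and $\mathcal M^*\downarrow(X,a)$ is the full subcategory of the slice category $V\text{-}\mathsf{Grp}\downarrow(X,a)$ on the coverings with codomain $(X,a)$. Internal actions. $Eq(f)$ is the kernel pair of $f$, i.e. the $V$-group $\{(y,y')\in Y\times Y\mid f(y)=f(y')\}$ with structure $b\wedge b$ (pointwise meet), regarded as an internal category (equivalence relation) in $V\text{-}\mathsf{Grp}$ with object of objects $(Y,b)$: domain $(y,y')\mapsto y$, codomain $(y,y')\mapsto y'$, identities $y\mapsto(y,y)$, composition of $(y,y')$ and $(y',y'')$ being $(y,y'')$. An internal $Eq(f)$-action in $V\text{-}\mathsf{Grp}$ is a triple $(A_0,\pi,\xi)$ with $A_0$ a $V$-group, $\pi:A_0\to Y$ a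 $V$-homomorphism, and $\xi:Eq(f)\times_Y A_0\to A_0$ a $V$-homomorphism defined on the pullback of the domain map and $\pi$ (i.e. on pairs $((y,y'),t)$ with $\pi(t)=y$), such that $\pi(\xi((y,y'),t))=y'$, $\xi((y',y''),\xi((y,y'),t))=\xi((y,y''),t)$ and $\xi((\pi(t),\pi(t)),t)=t$. A morphism $(A_0,\pi,\xi)\to(A_0',\pi',\xi')$ is a $V$-homomorphism $\phi_0:A_0\to A_0'$ with $\pi'\cdot\phi_0=\pi$ and $\phi_0(\xi((y,y'),t))=\xi'((y,y'),\phi_0(t))$. $V\text{-}\mathsf{Grp}_{\mathsf{sep}}^{\,Eq(f)}$ is the full subcategory of the category of internal $Eq(f)$-actions on those $(A_0,\pi,\xi)$ with $A_0$ separated. *)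

theory Defs
  imports "HOL-Algebra.Elementary_Groups"
begin

section \<open>Categories\<close>

text \<open>Hom-sets need not be disjoint, so composition and the action of functors on morphisms
  take the objects involved as arguments: \<open>Cmp C A B D g f\<close> is
  the composite of \<open>f : A \<rightarrow> B\<close> and \<open>g : B \<rightarrow> D\<close>.\<close>

record ('o, 'm) cat =
  Ob :: "'o set"
  Hom :: "'o \<Rightarrow> 'o \<Rightarrow> 'm set"
  Ident :: "'o \<Rightarrow> 'm"
  Cmp :: "'o \<Rightarrow> 'o \<Rightarrow> 'o \<Rightarrow> 'm \<Rightarrow> 'm \<Rightarrow> 'm"

locale category =
  fixes C :: "('o, 'm) cat"
  assumes Ident_in: "A \<in> Ob C \<Longrightarrow> Ident C A \<in> Hom C A A"
    and Cmp_in: "\<lbrakk>A \<in> Ob C; B \<in> Ob C; D \<in> Ob C; f \<in> Hom C A B; g \<in> Hom C B D\<rbrakk>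
      \<Longrightarrow> Cmp C A B D g f \<in> Hom C A D"
    and Cmp_Ident_left: "\<lbrakk>A \<in> Ob C; B \<in> Ob C; f \<in> Hom C A B\<rbrakk>
      \<Longrightarrow> Cmp C A B B (Ident C B) f = f"
    and Cmp_Ident_right: "\<lbrakk>A \<in> Ob C; B \<in> Ob C; f \<in> Hom C A B\<rbrakk>
      \<Longrightarrow> Cmp C A A B f (Ident C A) = f"
    and Cmp_assoc: "\<lbrakk>A \<in> Ob C; B \<in> Ob C; D \<in> Ob C; E \<in> Ob C;
        f \<in> Hom C A B; g \<in> Hom C B D; h \<in> Hom C D E\<rbrakk>
      \<Longrightarrow> Cmp C A D E h (Cmp C A B D g f) = Cmp C A B E (Cmp C B D E h g) f"

definition full_sub :: "('o, 'm) cat \<Rightarrow> ('o \<Rightarrow> bool) \<Rightarrow> ('o, 'm) cat" where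
  "full_sub C P = C\<lparr>Ob := {A \<in> Ob C. P A}\<rparr>"

record ('o, 'm, 'p, 'n) fctr =
  Fo :: "'o \<Rightarrow> 'p"
  Fm :: "'o \<Rightarrow> 'o \<Rightarrow> 'm \<Rightarrow> 'n"

locale cat_functor = C: category C + D: category D
  for C :: "('o, 'm) cat" and D :: "('p, 'n) cat" +
  fixes F :: "('o, 'm, 'p, 'n) fctr"
  assumes Fo_in: "A \<in> Ob C \<Longrightarrow> Fo F A \<in> Ob D"
    and Fm_in: "\<lbrakk>A \<in> Ob C; B \<in> Ob C; f \<in> Hom C A B\<rbrakk>
      \<Longrightarrow> Fm F A B f \<in> Hom D (Fo F A) (Fo F B)"
    and Fm_Ident: "A \<in> Ob C \<Longrightarrow> Fm F A A (Ident C A) = Ident D (Fo F A)"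
    and Fm_Cmp: "\<lbrakk>A \<in> Ob C; B \<in> Ob C; E \<in> Ob C; f \<in> Hom C A B; g \<in> Hom C B E\<rbrakk>
      \<Longrightarrow> Fm F A E (Cmp C A B E g f) =
        Cmp D (Fo F A) (Fo F B) (Fo F E) (Fm F B E g) (Fm F A B f)"

definition fid :: "('o, 'm, 'o, 'm) fctr" where
  "fid = \<lparr>Fo = (\<lambda>A. A), Fm = (\<lambda>A B f. f)\<rparr>"

definition fcomp ::
    "('p, 'n, 'q, 'l) fctr \<Rightarrow> ('o, 'm, 'p, 'n) fctr \<Rightarrow> ('o, 'm, 'q, 'l) fctr" where
  "fcomp G F = \<lparr>Fo = (\<lambda>A. Fo G (Fo F A)),
     Fm = (\<lambda>A B f. Fm G (Fo F A) (Fo F B) (Fm F A B f))\<rparr>"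

definition is_iso :: "('o, 'm) cat \<Rightarrow> 'o \<Rightarrow> 'o \<Rightarrow> 'm \<Rightarrow> bool" where
  "is_iso C A B f \<longleftrightarrow> f \<in> Hom C A B \<and>
     (\<exists>g \<in> Hom C B A. Cmp C A B A g f = Ident C A \<and> Cmp C B A B f g = Ident C B)"

definition nat_trans :: "('o, 'm) cat \<Rightarrow> ('p, 'n) cat \<Rightarrow> ('o, 'm, 'p, 'n) fctr \<Rightarrow>
    ('o, 'm, 'p, 'n) fctr \<Rightarrow> ('o \<Rightarrow> 'n) \<Rightarrow> bool" where
  "nat_trans C D F G \<eta> \<longleftrightarrow>
     (\<forall>A \<in> Ob C. \<eta> A \<in> Hom D (Fo F A) (Fo G A)) \<and>
     (\<forall>A \<in> Ob C. \<forall>B \<in> Ob C. \<forall>f \<in> Hom C A B.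
        Cmp D (Fo F A) (Fo F B) (Fo G B) (\<eta> B) (Fm F A B f) =
        Cmp D (Fo F A) (Fo G A) (Fo G B) (Fm G A B f) (\<eta> A))"

definition nat_iso :: "('o, 'm) cat \<Rightarrow> ('p, 'n) cat \<Rightarrow> ('o, 'm, 'p, 'n) fctr \<Rightarrow>
    ('o, 'm, 'p, 'n) fctr \<Rightarrow> ('o \<Rightarrow> 'n) \<Rightarrow> bool" where
  "nat_iso C D F G \<eta> \<longleftrightarrow> nat_trans C D F G \<eta> \<and>
     (\<forall>A \<in> Ob C. is_iso D (Fo F A) (Fo G A) (\<eta> A))"

definition is_equivalence ::
    "('o, 'm) cat \<Rightarrow> ('p, 'n) cat \<Rightarrow> ('o, 'm, 'p, 'n) fctr \<Rightarrow> bool" where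
  "is_equivalence C D F \<longleftrightarrow> cat_functor C D F \<and>
     (\<exists>G. cat_functor D C G \<and>
        (\<exists>\<eta>. nat_iso C C fid (fcomp G F) \<eta>) \<and>
        (\<exists>\<epsilon>. nat_iso D D (fcomp F G) fid \<epsilon>))"

definition equivalent_categories :: "('o, 'm) cat \<Rightarrow> ('p, 'n) cat \<Rightarrow> bool" where
  "equivalent_categories C D \<longleftrightarrow> (\<exists>F. is_equivalence C D F)"


section \<open>Monadic functors\<close>

text \<open>\<open>F : C \<rightarrow> D\<close> is left adjoint to \<open>G : D \<rightarrow> C\<close>, with unit \<open>\<eta>\<close> and counit \<open>\<epsilon>\<close>.\<close>

definition adjunction :: "('o, 'm) cat \<Rightarrow> ('p, 'n) cat \<Rightarrow> ('o, 'm, 'p, 'n) fctr \<Rightarrow>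
    ('p, 'n, 'o, 'm) fctr \<Rightarrow> ('o \<Rightarrow> 'm) \<Rightarrow> ('p \<Rightarrow> 'n) \<Rightarrow> bool" where
  "adjunction C D F G \<eta> \<epsilon> \<longleftrightarrow>
     cat_functor C D F \<and> cat_functor D C G \<and>
     nat_trans C C fid (fcomp G F) \<eta> \<and> nat_trans D D (fcomp F G) fid \<epsilon> \<and>
     (\<forall>A \<in> Ob C. Cmp D (Fo F A) (Fo F (Fo G (Fo F A))) (Fo F A)
        (\<epsilon> (Fo F A)) (Fm F A (Fo G (Fo F A)) (\<eta> A)) = Ident D (Fo F A)) \<and>
     (\<forall>B \<in> Ob D. Cmp C (Fo G B) (Fo G (Fo F (Fo G B))) (Fo G B)
        (Fm G (Fo F (Fo G B)) B (\<epsilon> B)) (\<eta> (Fo G B)) = Ident C (Fo G B))"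

text \<open>The Eilenberg--Moore category of a monad \<open>(T, \<eta>, \<mu>)\<close> on \<open>C\<close>.\<close>

definition eilenberg_moore :: "('o, 'm) cat \<Rightarrow> ('o, 'm, 'o, 'm) fctr \<Rightarrow> ('o \<Rightarrow> 'm) \<Rightarrow>
    ('o \<Rightarrow> 'm) \<Rightarrow> ('o \<times> 'm, 'm) cat" where
  "eilenberg_moore C T \<eta> \<mu> =
    \<lparr>Ob = {(A, \<alpha>). A \<in> Ob C \<and> \<alpha> \<in> Hom C (Fo T A) A \<and>
        Cmp C A (Fo T A) A \<alpha> (\<eta> A) = Ident C A \<and>
        Cmp C (Fo T (Fo T A)) (Fo T A) A \<alpha> (Fm T (Fo T A) A \<alpha>) =
          Cmp C (Fo T (Fo T A)) (Fo T A) A \<alpha> (\<mu> A)},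
     Hom = (\<lambda>(A, \<alpha>) (B, \<beta>). {h \<in> Hom C A B.
        Cmp C (Fo T A) A B h \<alpha> = Cmp C (Fo T A) (Fo T B) B \<beta> (Fm T A B h)}),
     Ident = (\<lambda>(A, \<alpha>). Ident C A),
     Cmp = (\<lambda>(A, \<alpha>) (B, \<beta>) (D, \<gamma>). Cmp C A B D)\<rparr>"

definition comparison :: "('p, 'n, 'o, 'm) fctr \<Rightarrow> ('o, 'm, 'p, 'n) fctr \<Rightarrow> ('p \<Rightarrow> 'n) \<Rightarrow>
    ('p, 'n, 'o \<times> 'm, 'm) fctr" where
  "comparison G F \<epsilon> =
    \<lparr>Fo = (\<lambda>B. (Fo G B, Fm G (Fo F (Fo G B)) B (\<epsilon> B))), Fm = Fm G\<rparr>"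

definition monadic :: "('p, 'n) cat \<Rightarrow> ('o, 'm) cat \<Rightarrow> ('p, 'n, 'o, 'm) fctr \<Rightarrow> bool" where
  "monadic D C G \<longleftrightarrow> (\<exists>F \<eta> \<epsilon>. adjunction C D F G \<eta> \<epsilon> \<and>
     is_equivalence D
       (eilenberg_moore C (fcomp G F) \<eta>
         (\<lambda>A. Fm G (Fo F (Fo G (Fo F A))) (Fo F A) (\<epsilon> (Fo F A))))
       (comparison G F \<epsilon>))"


section \<open>Slices, pullbacks and effective descent morphisms\<close>

definition slice :: "('o, 'm) cat \<Rightarrow> 'o \<Rightarrow> ('o \<times> 'm, 'm) cat" where
  "slice C B =
    \<lparr>Ob = {(Z, g). Z \<in> Ob C \<and> g \<in> Hom C Z B},
     Hom = (\<lambda>(Z, g) (Z', g'). {h \<in> Hom C Z Z'. Cmp C Z Z' B g' h = g}),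
     Ident = (\<lambda>(Z, g). Ident C Z),
     Cmp = (\<lambda>(Z, g) (Z', g') (Z'', g''). Cmp C Z Z' Z'')\<rparr>"

text \<open>\<open>is_pullback C P q r A f B g D\<close>: the square formed by \<open>q : P \<rightarrow> A\<close>, \<open>r : P \<rightarrow> B\<close>,
  \<open>f : A \<rightarrow> D\<close> and \<open>g : B \<rightarrow> D\<close> is a pullback.\<close>

definition is_pullback :: "('o, 'm) cat \<Rightarrow> 'o \<Rightarrow> 'm \<Rightarrow> 'm \<Rightarrow> 'o \<Rightarrow> 'm \<Rightarrow> 'o \<Rightarrow> 'm \<Rightarrow> 'o \<Rightarrow> bool"
  where
  "is_pullback C P q r A f B g D \<longleftrightarrow>
     P \<in> Ob C \<and> A \<in> Ob C \<and> B \<in> Ob C \<and> D \<in> Ob C \<and>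
     q \<in> Hom C P A \<and> r \<in> Hom C P B \<and> f \<in> Hom C A D \<and> g \<in> Hom C B D \<and>
     Cmp C P A D f q = Cmp C P B D g r \<and>
     (\<forall>W \<in> Ob C. \<forall>u \<in> Hom C W A. \<forall>v \<in> Hom C W B. Cmp C W A D f u = Cmp C W B D g v \<longrightarrow>
        (\<exists>!w. w \<in> Hom C W P \<and> Cmp C W P A q w = u \<and> Cmp C W P B r w = v))"

text \<open>\<open>Pb\<close> is a pullback functor \<open>p\<^sup>*\<close> from the slice over \<open>B\<close> to the slice over \<open>E\<close>;
  \<open>\<pi>\<close> collects the projections of the chosen pullbacks to the original total objects.\<close>

definition pullback_functor :: "('o, 'm) cat \<Rightarrow> 'o \<Rightarrow> 'o \<Rightarrow> 'm \<Rightarrow>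
    ('o \<times> 'm, 'm, 'o \<times> 'm, 'm) fctr \<Rightarrow> ('o \<times> 'm \<Rightarrow> 'm) \<Rightarrow> bool" where
  "pullback_functor C E B p Pb \<pi> \<longleftrightarrow>
     cat_functor (slice C B) (slice C E) Pb \<and>
     (\<forall>(Z, g) \<in> Ob (slice C B).
        is_pullback C (fst (Fo Pb (Z, g))) (snd (Fo Pb (Z, g))) (\<pi> (Z, g)) E p Z g B) \<and>
     (\<forall>(Z, g) \<in> Ob (slice C B). \<forall>(Z', g') \<in> Ob (slice C B).
        \<forall>h \<in> Hom (slice C B) (Z, g) (Z', g').
          Cmp C (fst (Fo Pb (Z, g))) (fst (Fo Pb (Z', g'))) Z'
            (\<pi> (Z', g')) (Fm Pb (Z, g) (Z', g') h) =
          Cmp C (fst (Fo Pb (Z, g))) Z Z' h (\<pi> (Z, g)))"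

definition effective_descent :: "('o, 'm) cat \<Rightarrow> 'o \<Rightarrow> 'o \<Rightarrow> 'm \<Rightarrow> bool" where
  "effective_descent C E B p \<longleftrightarrow> E \<in> Ob C \<and> B \<in> Ob C \<and> p \<in> Hom C E B \<and>
     (\<exists>Pb \<pi>. pullback_functor C E B p Pb \<pi> \<and> monadic (slice C B) (slice C E) Pb)"


section \<open>Quantales and V-groups\<close>

text \<open>The quantale \<open>V\<close> is a type; its tensor product and unit are \<open>*\<close> and \<open>1\<close>.\<close>

class comm_quantale = complete_lattice + comm_monoid_mult +
  assumes mult_Sup_distrib: "x * Sup A = (SUP y\<in>A. x * y)"

text \<open>The not necessarily commutative group operations are written multiplicatively, as in
  the group theory of the library.\<close>

record ('a, 'v) vgroup = "'a monoid" +
  rel :: "'a \<Rightarrow> 'a \<Rightarrow> 'v"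

definition vgroup_of :: "('a, 'm) monoid_scheme \<Rightarrow> ('a \<Rightarrow> 'a \<Rightarrow> 'v) \<Rightarrow> ('a, 'v) vgroup" where
  "vgroup_of G r = \<lparr>carrier = carrier G, monoid.mult = monoid.mult G, one = one G, rel = r\<rparr>"

locale v_category =
  fixes S :: "'a set" and r :: "'a \<Rightarrow> 'a \<Rightarrow> 'v::comm_quantale"
  assumes unit_le: "x \<in> S \<Longrightarrow> 1 \<le> r x x"
    and comp_le: "\<lbrakk>x \<in> S; x' \<in> S; x'' \<in> S\<rbrakk> \<Longrightarrow> r x x' * r x' x'' \<le> r x x''"

locale v_group = group X + v_category "carrier X" "rel X"
  for X :: "('a, 'v::comm_quantale) vgroup" (structure) +
  assumes mult_le: "\<lbrakk>x\<^sub>1 \<in> carrier X; x\<^sub>2 \<in> carrier X; y\<^sub>1 \<in> carrier X; y\<^sub>2 \<in> carrier X\<rbrakk>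
    \<Longrightarrow> rel X x\<^sub>1 x\<^sub>2 * rel X y\<^sub>1 y\<^sub>2 \<le> rel X (x\<^sub>1 \<otimes> y\<^sub>1) (x\<^sub>2 \<otimes> y\<^sub>2)"

text \<open>Maps are restricted to the carrier, so that equality of morphisms is equality of functions.\<close>

definition vhom :: "('a, 'v::comm_quantale) vgroup \<Rightarrow> ('b, 'v) vgroup \<Rightarrow> ('a \<Rightarrow> 'b) set" where
  "vhom X Y = {f \<in> hom X Y. f \<in> extensional (carrier X) \<and>
     (\<forall>x \<in> carrier X. \<forall>x' \<in> carrier X. rel X x x' \<le> rel Y (f x) (f x'))}"

text \<open>The category of V-groups whose carrier is a subset of the type \<open>'u\<close>, which plays the role
  of the universe of sets.\<close>

definition VGrp :: "(('u, 'v::comm_quantale) vgroup, 'u \<Rightarrow> 'u) cat" where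
  "VGrp = \<lparr>Ob = {X. v_group X}, Hom = vhom, Ident = (\<lambda>X. \<lambda>x\<in>carrier X. x),
     Cmp = (\<lambda>X Y Z g f. compose (carrier X) g f)\<rparr>"

definition separated :: "('a, 'v::comm_quantale) vgroup \<Rightarrow> bool" where
  "separated X \<longleftrightarrow> (\<forall>x \<in> carrier X. \<forall>x' \<in> carrier X.
     1 \<le> rel X x x' \<and> 1 \<le> rel X x' x \<longrightarrow> x = x')"

text \<open>The isomorphic copy of a V-group along a map \<open>e\<close> that is injective on its carrier. It is used
  to move V-groups whose elements are pairs or cosets back into the universe.\<close>

definition vg_copy :: "('a \<Rightarrow> 'b) \<Rightarrow> ('a, 'v::comm_quantale) vgroup \<Rightarrow> ('b, 'v) vgroup" where
  "vg_copy e X = (let d = inv_into (carrier X) e in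
     \<lparr>carrier = e ` carrier X, monoid.mult = (\<lambda>x y. e (d x \<otimes>\<^bsub>X\<^esub> d y)), one = e \<one>\<^bsub>X\<^esub>,
      rel = (\<lambda>x y. rel X (d x) (d y))\<rparr>)"

definition vg_pullback :: "('a, 'v::comm_quantale) vgroup \<Rightarrow> ('a \<Rightarrow> 'c) \<Rightarrow> ('b, 'v) vgroup \<Rightarrow>
    ('b \<Rightarrow> 'c) \<Rightarrow> ('a \<times> 'b, 'v) vgroup" where
  "vg_pullback X f Y g =
     vgroup_of ((X \<times>\<times> Y)\<lparr>carrier := {(x, y). x \<in> carrier X \<and> y \<in> carrier Y \<and> f x = g y}\<rparr>)
       (\<lambda>(x, y) (x', y'). inf (rel X x x') (rel Y y y'))"


section \<open>The separated reflection and coverings\<close>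

definition sep_kernel :: "('a, 'v::comm_quantale) vgroup \<Rightarrow> 'a set" where
  "sep_kernel X = {x \<in> carrier X. 1 \<le> rel X \<one>\<^bsub>X\<^esub> x \<and> 1 \<le> rel X x \<one>\<^bsub>X\<^esub>}"

definition sep_quot :: "('a, 'v::comm_quantale) vgroup \<Rightarrow> ('a set, 'v) vgroup" where
  "sep_quot X = vgroup_of (X Mod sep_kernel X)
     (\<lambda>z\<^sub>1 z\<^sub>2. Sup {rel X x\<^sub>1 x\<^sub>2 | x\<^sub>1 x\<^sub>2. x\<^sub>1 \<in> carrier X \<and> x\<^sub>2 \<in> carrier X \<and>
        sep_kernel X #>\<^bsub>X\<^esub> x\<^sub>1 = z\<^sub>1 \<and> sep_kernel X #>\<^bsub>X\<^esub> x\<^sub>2 = z\<^sub>2})"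

text \<open>The quotient is carried by sets of elements; to have it in the universe of \<open>X\<close> again, each
  coset is replaced by a chosen representative.\<close>

definition coset_rep :: "'a set \<Rightarrow> 'a" where
  "coset_rep K = (SOME x. x \<in> K)"

definition sep_refl :: "('a, 'v::comm_quantale) vgroup \<Rightarrow> ('a, 'v) vgroup" where
  "sep_refl X = vg_copy coset_rep (sep_quot X)"

definition sep_unit :: "('a, 'v::comm_quantale) vgroup \<Rightarrow> 'a \<Rightarrow> 'a" where
  "sep_unit X = (\<lambda>x\<in>carrier X. coset_rep (sep_kernel X #>\<^bsub>X\<^esub> x))"

definition sep_refl_map ::
    "('a, 'v::comm_quantale) vgroup \<Rightarrow> ('a, 'v) vgroup \<Rightarrow> ('a \<Rightarrow> 'a) \<Rightarrow> 'a \<Rightarrow> 'a" where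
  "sep_refl_map Z X g = (THE h. h \<in> vhom (sep_refl Z) (sep_refl X) \<and>
     compose (carrier Z) h (sep_unit Z) = compose (carrier Z) (sep_unit X) g)"

definition trivial_covering ::
    "('u, 'v::comm_quantale) vgroup \<Rightarrow> ('u, 'v) vgroup \<Rightarrow> ('u \<Rightarrow> 'u) \<Rightarrow> bool" where
  "trivial_covering Z X g \<longleftrightarrow> g \<in> vhom Z X \<and>
     is_pullback VGrp Z g (sep_unit Z) X (sep_unit X)
       (sep_refl Z) (sep_refl_map Z X g) (sep_refl X)"

definition covering ::
    "('u, 'v::comm_quantale) vgroup \<Rightarrow> ('u, 'v) vgroup \<Rightarrow> ('u \<Rightarrow> 'u) \<Rightarrow> bool" where
  "covering Z X g \<longleftrightarrow> g \<in> vhom Z X \<and>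
     (\<exists>E p P q r. effective_descent VGrp E X p \<and> is_pullback VGrp P q r E p Z g X \<and>
        trivial_covering P E q)"

definition coverings_over ::
    "('u, 'v::comm_quantale) vgroup \<Rightarrow> (('u, 'v) vgroup \<times> ('u \<Rightarrow> 'u), 'u \<Rightarrow> 'u) cat" where
  "coverings_over X = full_sub (slice VGrp X) (\<lambda>(Z, g). covering Z X g)"


section \<open>Internal actions of a kernel pair\<close>

definition Eq_pair :: "('a, 'v::comm_quantale) vgroup \<Rightarrow> ('a \<Rightarrow> 'b) \<Rightarrow> ('a \<times> 'a, 'v) vgroup" where
  "Eq_pair Y f = vg_pullback Y f Y f"

definition Eq_action :: "('a, 'v::comm_quantale) vgroup \<Rightarrow> ('a \<Rightarrow> 'b) \<Rightarrow>
    ('u, 'v) vgroup \<Rightarrow> ('u \<Rightarrow> 'a) \<Rightarrow> (('a \<times> 'a) \<times> 'u \<Rightarrow> 'u) \<Rightarrow> bool" where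
  "Eq_action Y f A \<pi> \<xi> \<longleftrightarrow> v_group A \<and> \<pi> \<in> vhom A Y \<and>
     \<xi> \<in> vhom (vg_pullback (Eq_pair Y f) fst A \<pi>) A \<and>
     (\<forall>y y' t. (y, y') \<in> carrier (Eq_pair Y f) \<and> t \<in> carrier A \<and> \<pi> t = y \<longrightarrow>
        \<pi> (\<xi> ((y, y'), t)) = y') \<and>
     (\<forall>y y' y'' t. (y, y') \<in> carrier (Eq_pair Y f) \<and> (y', y'') \<in> carrier (Eq_pair Y f) \<and>
        t \<in> carrier A \<and> \<pi> t = y \<longrightarrow>
        \<xi> ((y', y''), \<xi> ((y, y'), t)) = \<xi> ((y, y''), t)) \<and>
     (\<forall>t \<in> carrier A. \<xi> ((\<pi> t, \<pi> t), t) = t)"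

definition Eq_actions :: "('a, 'v::comm_quantale) vgroup \<Rightarrow> ('a \<Rightarrow> 'b) \<Rightarrow>
    (('u, 'v) vgroup \<times> ('u \<Rightarrow> 'a) \<times> (('a \<times> 'a) \<times> 'u \<Rightarrow> 'u), 'u \<Rightarrow> 'u) cat" where
  "Eq_actions Y f =
    \<lparr>Ob = {(A, \<pi>, \<xi>). Eq_action Y f A \<pi> \<xi>},
     Hom = (\<lambda>(A, \<pi>, \<xi>) (A', \<pi>', \<xi>'). {\<phi> \<in> vhom A A'.
        (\<forall>t \<in> carrier A. \<pi>' (\<phi> t) = \<pi> t) \<and>
        (\<forall>y y' t. (y, y') \<in> carrier (Eq_pair Y f) \<and> t \<in> carrier A \<and> \<pi> t = y \<longrightarrow>
           \<phi> (\<xi> ((y, y'), t)) = \<xi>' ((y, y'), \<phi> t))}),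
     Ident = (\<lambda>(A, \<pi>, \<xi>). \<lambda>t\<in>carrier A. t),
     Cmp = (\<lambda>(A, \<pi>, \<xi>) (A', \<pi>', \<xi>') (A'', \<pi>'', \<xi>''). \<lambda>\<psi> \<phi>. compose (carrier A) \<psi> \<phi>)\<rparr>"

definition sep_Eq_actions :: "('a, 'v::comm_quantale) vgroup \<Rightarrow> ('a \<Rightarrow> 'b) \<Rightarrow>
    (('u, 'v) vgroup \<times> ('u \<Rightarrow> 'a) \<times> (('a \<times> 'a) \<times> 'u \<Rightarrow> 'u), 'u \<Rightarrow> 'u) cat" where
  "sep_Eq_actions Y f = full_sub (Eq_actions Y f) (\<lambda>(A, \<pi>, \<xi>). separated A)"


section \<open>The V-group on the product of the integers with a V-group\<close>

definition int_ext :: "('a, 'v::comm_quantale) vgroup \<Rightarrow> (int \<times> 'a, 'v) vgroup" where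
  "int_ext X = vgroup_of (integer_group \<times>\<times> X)
     (\<lambda>(z, x) (z', x'). if z < z' then rel X x x' else if z = z' \<and> x = x' then Orderings.top else bot)"

end

theory Submission
  imports Defs
begin

text \<open>Between two levels \<open>m < n\<close> of \<open>Y = \<int> \<times> X\<close> the structure of \<open>Y\<close> is a copy of that of \<open>X\<close>. An
  \<open>Eq(f)\<close>-action on \<open>A\<close> over \<open>Y\<close> therefore descends to the subgroup \<open>Z\<close> of elements of level \<open>0\<close>,
  with structure \<open>c(t, t') = a\<^sub>A(t, (1, x') \<cdot> t')\<close>, where \<open>x'\<close> is the image of \<open>t'\<close> in \<open>X\<close>; this gives
  essential surjectivity of the comparison functor of \<open>f\<^sup>*\<close>, and a similar use of the levels \<open>0\<close> and
  \<open>1\<close> gives full faithfulness. Hence \<open>f\<^sup>*\<close> is monadic, with the \<open>Eq(f)\<close>-actions as algebras.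

  A covering \<open>g : Z \<rightarrow> X\<close> satisfies \<open>ker g \<inter> N\<^sub>Z = 0\<close>: test the pullback squares in question on this
  subgroup. As \<open>Y\<close> is separated, the condition says that \<open>Y \<times>\<^sub>X Z\<close> is separated, and then the
  projection \<open>Y \<times>\<^sub>X Z \<rightarrow> Y\<close> is a trivial covering, both units being identities. So the equivalence restricts to
  coverings on one side and actions on separated V-groups on the other.\<close>

section \<open>Categories and equivalences\<close>

text \<open>Each level of Y is discrete: distinct elements of one level have value bot. As
  \<open>\<pi>\<close> is a V-homomorphism, the structure of A between level-0 elements with
  different images in X is bot too, so restricting it to level 0 would lose the structure of X; this
  forces the upward shift of the second argument. The shift by one is a mere choice, since the
  action carries a pair of elements to any levels m < n without lowering its value. Effective
  descent is defined through monadicity, so \<open>f\<close> has to be shown monadic before it can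
  witness a covering. Algebras for the monad and internal actions present the same data; the descent
  construction is done once, for an action in curried form, and used for both. Integrality makes
  zero maps V-homomorphisms, as the tests on subgroups require; non-triviality makes Y
  separated.\<close>

lemma category_slice:
  assumes "category C" and B: "B \<in> Ob C"
  shows "category (slice C B)"
proof -
  interpret category C by fact
  show ?thesis
  proof
    fix A assume "A \<in> Ob (slice C B)"
    then show "Ident (slice C B) A \<in> Hom (slice C B) A A"
      using B by (auto simp: slice_def Ident_in Cmp_Ident_right)
  next
    fix P Q R p q
    assume "P \<in> Ob (slice C B)" "Q \<in> Ob (slice C B)" "R \<in> Ob (slice C B)"
      "p \<in> Hom (slice C B) P Q" "q \<in> Hom (slice C B) Q R"
    then show "Cmp (slice C B) P Q R q p \<in> Hom (slice C B) P R"
      using B by (auto simp: slice_def Cmp_in Cmp_assoc)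
  next
    fix P Q p assume "P \<in> Ob (slice C B)" "Q \<in> Ob (slice C B)" "p \<in> Hom (slice C B) P Q"
    then show "Cmp (slice C B) P Q Q (Ident (slice C B) Q) p = p"
      by (auto simp: slice_def Cmp_Ident_left)
  next
    fix P Q p assume "P \<in> Ob (slice C B)" "Q \<in> Ob (slice C B)" "p \<in> Hom (slice C B) P Q"
    then show "Cmp (slice C B) P P Q p (Ident (slice C B) P) = p"
      by (auto simp: slice_def Cmp_Ident_right)
  next
    fix P Q R S p q r
    assume "P \<in> Ob (slice C B)" "Q \<in> Ob (slice C B)" "R \<in> Ob (slice C B)" "S \<in> Ob (slice C B)"
      "p \<in> Hom (slice C B) P Q" "q \<in> Hom (slice C B) Q R" "r \<in> Hom (slice C B) R S"
    then show "Cmp (slice C B) P R S r (Cmp (slice C B) P Q R q p) =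
        Cmp (slice C B) P Q S (Cmp (slice C B) Q R S r q) p"
      by (auto simp: slice_def Cmp_assoc)
  qed
qed

lemma category_full_sub:
  assumes "category C"
  shows "category (full_sub C P)"
proof -
  interpret category C by fact
  show ?thesis
    by unfold_locales
      (auto simp: full_sub_def Ident_in Cmp_in Cmp_Ident_left Cmp_Ident_right Cmp_assoc)
qed

lemma cat_functor_fcomp:
  assumes "cat_functor C D F" and "cat_functor D E G"
  shows "cat_functor C E (fcomp G F)"
proof -
  interpret F: cat_functor C D F by fact
  interpret G: cat_functor D E G by fact
  show ?thesis
    by unfold_locales
      (auto simp: fcomp_def F.Fo_in G.Fo_in F.Fm_in G.Fm_in F.Fm_Ident G.Fm_Ident F.Fm_Cmp G.Fm_Cmp)
qed

lemma category_eilenberg_moore: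
  assumes "cat_functor C C T"
  shows "category (eilenberg_moore C T \<eta> \<mu>)"
proof -
  interpret T: cat_functor C C T by fact
  note [simp] = eilenberg_moore_def T.C.Ident_in T.C.Cmp_in T.C.Cmp_Ident_left T.C.Cmp_Ident_right
    T.Fo_in T.Fm_in T.Fm_Ident T.Fm_Cmp
  let ?M = "eilenberg_moore C T \<eta> \<mu>"
  show ?thesis
  proof
    fix P assume "P \<in> Ob ?M"
    then show "Ident ?M P \<in> Hom ?M P P" by auto
  next
    fix P Q R p q
    assume *: "P \<in> Ob ?M" "Q \<in> Ob ?M" "R \<in> Ob ?M" "p \<in> Hom ?M P Q" "q \<in> Hom ?M Q R"
    obtain A \<alpha> where P: "P = (A, \<alpha>)" by (cases P)
    obtain B \<beta> where Q: "Q = (B, \<beta>)" by (cases Q)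
    obtain D \<delta> where R: "R = (D, \<delta>)" by (cases R)
    have o: "A \<in> Ob C" "B \<in> Ob C" "D \<in> Ob C" "\<alpha> \<in> Hom C (Fo T A) A" "\<beta> \<in> Hom C (Fo T B) B"
      "\<delta> \<in> Hom C (Fo T D) D" "p \<in> Hom C A B" "q \<in> Hom C B D"
      and p: "Cmp C (Fo T A) A B p \<alpha> = Cmp C (Fo T A) (Fo T B) B \<beta> (Fm T A B p)"
      and q: "Cmp C (Fo T B) B D q \<beta> = Cmp C (Fo T B) (Fo T D) D \<delta> (Fm T B D q)"
      using * by (auto simp: P Q R)
    have "Cmp C (Fo T A) A D (Cmp C A B D q p) \<alpha> =
        Cmp C (Fo T A) B D q (Cmp C (Fo T A) A B p \<alpha>)"
      by (rule T.C.Cmp_assoc[symmetric]) (use o in auto)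
    also have "\<dots> = Cmp C (Fo T A) (Fo T B) D (Cmp C (Fo T B) B D q \<beta>) (Fm T A B p)"
      unfolding p by (rule T.C.Cmp_assoc) (use o in auto)
    also have "\<dots> = Cmp C (Fo T A) (Fo T D) D \<delta>
        (Cmp C (Fo T A) (Fo T B) (Fo T D) (Fm T B D q) (Fm T A B p))"
      unfolding q by (rule T.C.Cmp_assoc[symmetric]) (use o in auto)
    finally show "Cmp ?M P Q R q p \<in> Hom ?M P R"
      using o by (simp add: P Q R)
  next
    fix P Q p assume "P \<in> Ob ?M" "Q \<in> Ob ?M" "p \<in> Hom ?M P Q"
    then show "Cmp ?M P Q Q (Ident ?M Q) p = p" by auto
  next
    fix P Q p assume "P \<in> Ob ?M" "Q \<in> Ob ?M" "p \<in> Hom ?M P Q"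
    then show "Cmp ?M P P Q p (Ident ?M P) = p" by auto
  next
    fix P Q R S p q r
    assume "P \<in> Ob ?M" "Q \<in> Ob ?M" "R \<in> Ob ?M" "S \<in> Ob ?M"
      "p \<in> Hom ?M P Q" "q \<in> Hom ?M Q R" "r \<in> Hom ?M R S"
    then show "Cmp ?M P R S r (Cmp ?M P Q R q p) = Cmp ?M P Q S (Cmp ?M Q R S r q) p"
      by (auto simp: T.C.Cmp_assoc)
  qed
qed

text \<open>One square, naturality of the counit with \<open>G\<close> applied
  (\<open>Gnat\<close>), has two readings: for a general \<open>h\<close> it says that
  \<open>G h\<close> is a homomorphism of algebras, and for \<open>h = \<epsilon> B\<close> it is
  the associativity law of the algebra on \<open>G B\<close>. The unit law is a triangle
  identity.\<close>

lemma cat_functor_comparison: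
  assumes adj: "adjunction C D F G \<eta> \<epsilon>"
  shows "cat_functor D (eilenberg_moore C (fcomp G F) \<eta>
      (\<lambda>A. Fm G (Fo F (Fo G (Fo F A))) (Fo F A) (\<epsilon> (Fo F A)))) (comparison G F \<epsilon>)"
    (is "cat_functor D ?M ?K")
proof -
  interpret F: cat_functor C D F using adj by (simp add: adjunction_def)
  interpret G: cat_functor D C G using adj by (simp add: adjunction_def)
  interpret T: cat_functor C C "fcomp G F"
    by (rule cat_functor_fcomp) unfold_locales
  interpret M: category ?M by (rule category_eilenberg_moore) unfold_locales
  note [simp] = F.Fo_in G.Fo_in F.Fm_in G.Fm_in F.Fm_Ident G.Fm_Ident
  have eps[simp]: "\<epsilon> B \<in> Hom D (Fo F (Fo G B)) B" if "B \<in> Ob D" for B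
    using adj that by (simp add: adjunction_def nat_trans_def fcomp_def fid_def)
  have nat: "Cmp D (Fo F (Fo G A)) (Fo F (Fo G B)) B (\<epsilon> B) (Fm F (Fo G A) (Fo G B) (Fm G A B h)) =
      Cmp D (Fo F (Fo G A)) A B h (\<epsilon> A)"
    if "A \<in> Ob D" "B \<in> Ob D" "h \<in> Hom D A B" for A B h
    using adj that by (simp add: adjunction_def nat_trans_def fcomp_def fid_def)
  have tri: "Cmp C (Fo G B) (Fo G (Fo F (Fo G B))) (Fo G B)
        (Fm G (Fo F (Fo G B)) B (\<epsilon> B)) (\<eta> (Fo G B)) = Ident C (Fo G B)" if "B \<in> Ob D" for B
    using adj that by (simp add: adjunction_def)
  have Gnat: "Cmp C (Fo G (Fo F (Fo G A))) (Fo G (Fo F (Fo G B))) (Fo G B)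
        (Fm G (Fo F (Fo G B)) B (\<epsilon> B))
        (Fm G (Fo F (Fo G A)) (Fo F (Fo G B)) (Fm F (Fo G A) (Fo G B) (Fm G A B h))) =
      Cmp C (Fo G (Fo F (Fo G A))) (Fo G A) (Fo G B) (Fm G A B h)
        (Fm G (Fo F (Fo G A)) A (\<epsilon> A))"
    if "A \<in> Ob D" "B \<in> Ob D" "h \<in> Hom D A B" for A B h
    using that nat[OF that] by (simp flip: G.Fm_Cmp)
  show ?thesis
  proof
    fix B assume "B \<in> Ob D"
    then show "Fo ?K B \<in> Ob ?M"
      using Gnat[of "Fo F (Fo G B)" B "\<epsilon> B"]
      by (simp add: eilenberg_moore_def comparison_def fcomp_def tri)
  next
    fix A B h assume "A \<in> Ob D" "B \<in> Ob D" "h \<in> Hom D A B"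
    then show "Fm ?K A B h \<in> Hom ?M (Fo ?K A) (Fo ?K B)"
      by (simp add: eilenberg_moore_def comparison_def fcomp_def Gnat)
  next
    fix B assume "B \<in> Ob D"
    then show "Fm ?K B B (Ident D B) = Ident ?M (Fo ?K B)"
      by (simp add: eilenberg_moore_def comparison_def)
  next
    fix A B E h k assume "A \<in> Ob D" "B \<in> Ob D" "E \<in> Ob D" "h \<in> Hom D A B" "k \<in> Hom D B E"
    then show "Fm ?K A E (Cmp D A B E k h) =
        Cmp ?M (Fo ?K A) (Fo ?K B) (Fo ?K E) (Fm ?K B E k) (Fm ?K A B h)"
      by (simp add: eilenberg_moore_def comparison_def G.Fm_Cmp)
  qed
qed

text \<open>The quasi-inverse chooses for each \<open>E\<close> an object \<open>go E\<close> with
  inverse isomorphisms \<phi> and \<psi>, and sends a morphism \<open>k\<close> to the unique lift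
  along \<open>F\<close> of its conjugate by them. Faithfulness moves the required equations from
  \<open>C\<close> to \<open>D\<close>.\<close>

lemma is_equivalence_if_fully_faithful_ess_surj:
  assumes "cat_functor C D F"
    and ff: "\<And>A B k. \<lbrakk>A \<in> Ob C; B \<in> Ob C; k \<in> Hom D (Fo F A) (Fo F B)\<rbrakk>
      \<Longrightarrow> \<exists>!h. h \<in> Hom C A B \<and> Fm F A B h = k"
    and eso: "\<And>E. E \<in> Ob D \<Longrightarrow> \<exists>A\<in>Ob C. \<exists>\<phi>. is_iso D (Fo F A) E \<phi>"
  shows "is_equivalence C D F"
proof -
  interpret F: cat_functor C D F by fact
  have "\<forall>E\<in>Ob D. \<exists>A \<phi> \<psi>. A \<in> Ob C \<and> \<phi> \<in> Hom D (Fo F A) E \<and> \<psi> \<in> Hom D E (Fo F A) \<and>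
      Cmp D (Fo F A) E (Fo F A) \<psi> \<phi> = Ident D (Fo F A) \<and> Cmp D E (Fo F A) E \<phi> \<psi> = Ident D E"
    using eso unfolding is_iso_def by blast
  then obtain go \<phi> \<psi> where go: "\<And>E. E \<in> Ob D \<Longrightarrow> go E \<in> Ob C"
    and \<phi>: "\<And>E. E \<in> Ob D \<Longrightarrow> \<phi> E \<in> Hom D (Fo F (go E)) E"
    and \<psi>: "\<And>E. E \<in> Ob D \<Longrightarrow> \<psi> E \<in> Hom D E (Fo F (go E))"
    and \<psi>\<phi>: "\<And>E. E \<in> Ob D \<Longrightarrow>
      Cmp D (Fo F (go E)) E (Fo F (go E)) (\<psi> E) (\<phi> E) = Ident D (Fo F (go E))"
    and \<phi>\<psi>: "\<And>E. E \<in> Ob D \<Longrightarrow> Cmp D E (Fo F (go E)) E (\<phi> E) (\<psi> E) = Ident D E"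
    by metis
  define lift where "lift A B k = (THE h. h \<in> Hom C A B \<and> Fm F A B h = k)" for A B k
  have lift: "lift A B k \<in> Hom C A B \<and> Fm F A B (lift A B k) = k"
    if "A \<in> Ob C" "B \<in> Ob C" "k \<in> Hom D (Fo F A) (Fo F B)" for A B k
    unfolding lift_def by (rule theI'[OF ff[OF that]])
  have faithful: "h = h'" if "A \<in> Ob C" "B \<in> Ob C" "h \<in> Hom C A B" "h' \<in> Hom C A B"
    "Fm F A B h = Fm F A B h'" for A B h h'
    using ff[OF that(1,2) F.Fm_in[OF that(1-3)]] that by metis
  note [simp] = F.Fo_in F.Fm_in F.Fm_Ident F.Fm_Cmp go \<phi> \<psi> lift
    F.C.Ident_in F.C.Cmp_in F.C.Cmp_Ident_left F.C.Cmp_Ident_right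
    F.D.Ident_in F.D.Cmp_in F.D.Cmp_Ident_left F.D.Cmp_Ident_right
  \<comment> \<open>\<open>\<phi> E\<close> has the left inverse \<open>\<psi> E\<close>, so maps
    into \<open>Fo F (go E)\<close> may be compared after composing with \<open>\<phi> E\<close>;
    there the conjugate \<open>m E E' k\<close> turns into \<open>k\<close> after \<phi> and no
    \<psi> is left.\<close>
  have mono: "a = b" if "E \<in> Ob D" "W \<in> Ob D" "a \<in> Hom D W (Fo F (go E))"
      "b \<in> Hom D W (Fo F (go E))"
      "Cmp D W (Fo F (go E)) E (\<phi> E) a = Cmp D W (Fo F (go E)) E (\<phi> E) b" for E W a b
  proof -
    have *: "Cmp D W E (Fo F (go E)) (\<psi> E) (Cmp D W (Fo F (go E)) E (\<phi> E) c) = c"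
      if c: "c \<in> Hom D W (Fo F (go E))" for c
      using c \<open>E \<in> Ob D\<close> \<open>W \<in> Ob D\<close> by (simp add: F.D.Cmp_assoc \<psi>\<phi>)
    show ?thesis using *[OF that(3)] *[OF that(4)] that(5) by metis
  qed
  define m where "m E E' k = Cmp D (Fo F (go E)) E' (Fo F (go E')) (\<psi> E')
      (Cmp D (Fo F (go E)) E E' k (\<phi> E))" for E E' k
  have m[simp]: "m E E' k \<in> Hom D (Fo F (go E)) (Fo F (go E'))"
    and \<phi>m: "Cmp D (Fo F (go E)) (Fo F (go E')) E' (\<phi> E') (m E E' k) =
        Cmp D (Fo F (go E)) E E' k (\<phi> E)"
    if "E \<in> Ob D" "E' \<in> Ob D" "k \<in> Hom D E E'" for E E' k
    using that by (simp_all add: m_def F.D.Cmp_assoc \<phi>\<psi>)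
  define G where "G = \<lparr>Fo = go, Fm = (\<lambda>E E' k. lift (go E) (go E') (m E E' k))\<rparr>"
  have Go[simp]: "Fo G = go" by (simp add: G_def)
  have G_in[simp]: "Fm G E E' k \<in> Hom C (go E) (go E')"
    and FG[simp]: "Fm F (go E) (go E') (Fm G E E' k) = m E E' k"
    if "E \<in> Ob D" "E' \<in> Ob D" "k \<in> Hom D E E'" for E E' k
    using that by (simp_all add: G_def)
  have "cat_functor D C G"
  proof unfold_locales
    fix A B k assume "A \<in> Ob D" "B \<in> Ob D" "k \<in> Hom D A B"
    then show "Fm G A B k \<in> Hom C (Fo G A) (Fo G B)" by simp
  next
    fix E assume E: "E \<in> Ob D"
    have "m E E (Ident D E) = Ident D (Fo F (go E))"
      by (rule mono[of E "Fo F (go E)"]) (use E in \<open>simp_all add: \<phi>m\<close>)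
    then show "Fm G E E (Ident D E) = Ident C (Fo G E)"
      using E by (intro faithful[of "go E" "go E"]) simp_all
  next
    fix A B E k l
    assume *: "A \<in> Ob D" "B \<in> Ob D" "E \<in> Ob D" "k \<in> Hom D A B" "l \<in> Hom D B E"
    have "m A E (Cmp D A B E l k) =
        Cmp D (Fo F (go A)) (Fo F (go B)) (Fo F (go E)) (m B E l) (m A B k)"
    proof (rule mono[of E "Fo F (go A)"])
      have "Cmp D (Fo F (go A)) (Fo F (go E)) E (\<phi> E)
          (Cmp D (Fo F (go A)) (Fo F (go B)) (Fo F (go E)) (m B E l) (m A B k)) =
          Cmp D (Fo F (go A)) (Fo F (go B)) E (Cmp D (Fo F (go B)) B E l (\<phi> B)) (m A B k)"
        using * by (simp add: F.D.Cmp_assoc \<phi>m)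
      also have "\<dots> = Cmp D (Fo F (go A)) B E l (Cmp D (Fo F (go A)) A B k (\<phi> A))"
        using * by (simp add: F.D.Cmp_assoc[symmetric] \<phi>m)
      also have "\<dots> = Cmp D (Fo F (go A)) (Fo F (go E)) E (\<phi> E) (m A E (Cmp D A B E l k))"
        using * by (simp add: \<phi>m F.D.Cmp_assoc)
      finally show "Cmp D (Fo F (go A)) (Fo F (go E)) E (\<phi> E) (m A E (Cmp D A B E l k)) =
          Cmp D (Fo F (go A)) (Fo F (go E)) E (\<phi> E)
          (Cmp D (Fo F (go A)) (Fo F (go B)) (Fo F (go E)) (m B E l) (m A B k))" ..
    qed (use * in simp_all)
    then show "Fm G A E (Cmp D A B E l k) =
        Cmp C (Fo G A) (Fo G B) (Fo G E) (Fm G B E l) (Fm G A B k)"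
      using * by (intro faithful[of "go A" "go E"]) simp_all
  qed simp_all
  moreover have "nat_iso C C fid (fcomp G F) (\<lambda>A. lift A (go (Fo F A)) (\<psi> (Fo F A)))"
    (is "nat_iso C C _ _ ?\<eta>")
    unfolding nat_iso_def nat_trans_def
  proof (intro conjI ballI)
    fix A assume "A \<in> Ob C"
    then show "?\<eta> A \<in> Hom C (Fo fid A) (Fo (fcomp G F) A)" by (simp add: fid_def fcomp_def)
  next
    fix A B h assume *: "A \<in> Ob C" "B \<in> Ob C" "h \<in> Hom C A B"
    let ?A = "Fo F A" and ?B = "Fo F B"
    have "Cmp D ?A (Fo F (go ?A)) (Fo F (go ?B)) (m ?A ?B (Fm F A B h)) (\<psi> ?A) =
        Cmp D ?A ?B (Fo F (go ?B)) (\<psi> ?B) (Fm F A B h)"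
      by (rule mono[of ?B ?A])
        (use * in \<open>simp_all add: F.D.Cmp_assoc \<phi>m \<phi>\<psi>\<close>, simp add: F.D.Cmp_assoc[symmetric] \<phi>\<psi>)
    then have "Cmp C A B (go ?B) (?\<eta> B) h = Cmp C A (go ?A) (go ?B) (Fm G ?A ?B (Fm F A B h)) (?\<eta> A)"
      using * by (intro faithful[of A "go ?B"]) simp_all
    then show "Cmp C (Fo fid A) (Fo fid B) (Fo (fcomp G F) B) (?\<eta> B) (Fm fid A B h) =
        Cmp C (Fo fid A) (Fo (fcomp G F) A) (Fo (fcomp G F) B) (Fm (fcomp G F) A B h) (?\<eta> A)"
      by (simp add: fid_def fcomp_def)
  next
    fix A assume A: "A \<in> Ob C"
    let ?i = "lift (go (Fo F A)) A (\<phi> (Fo F A))"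
    have "Cmp C A (go (Fo F A)) A ?i (?\<eta> A) = Ident C A"
      using A by (intro faithful[of A A]) (simp_all add: \<phi>\<psi>)
    moreover have "Cmp C (go (Fo F A)) A (go (Fo F A)) (?\<eta> A) ?i = Ident C (go (Fo F A))"
      using A by (intro faithful[of "go (Fo F A)" "go (Fo F A)"]) (simp_all add: \<psi>\<phi>)
    ultimately show "is_iso C (Fo fid A) (Fo (fcomp G F) A) (?\<eta> A)"
      using A by (auto simp: is_iso_def fid_def fcomp_def intro!: bexI[of _ ?i])
  qed
  moreover have "nat_iso D D (fcomp F G) fid \<phi>"
    unfolding nat_iso_def nat_trans_def is_iso_def
    by (auto simp: fcomp_def fid_def \<phi>m) (use \<psi> \<phi>\<psi> \<psi>\<phi> in blast)
  ultimately show ?thesis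
    unfolding is_equivalence_def using \<open>cat_functor C D F\<close> by blast
qed

section \<open>V-groups and separatedness\<close>

text \<open>The order is encoded in joins: if \<open>y \<le> z\<close>, then \<open>z\<close> is the
  join of the set of \<open>y\<close> and \<open>z\<close>, and tensoring with \<open>x\<close>
  preserves it.\<close>

lemma quantale_mult_mono:
  fixes a b c d :: "'v::comm_quantale"
  assumes "a \<le> b" and "c \<le> d"
  shows "a * c \<le> b * d"
proof -
  have mono: "x * y \<le> x * z" if "y \<le> z" for x y z :: 'v
  proof -
    have "x * z = sup (x * y) (x * z)"
      using mult_Sup_distrib[of x "{y, z}"] that by (simp add: sup_absorb2)
    then show ?thesis by (metis sup_ge1)
  qed
  have "a * c \<le> a * d" by (rule mono) fact
  also have "\<dots> \<le> b * d" using mono[OF \<open>a \<le> b\<close>, of d] by (simp add: mult.commute)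
  finally show ?thesis .
qed

lemma quantale_mult_bot: "x * bot = (bot :: 'v::comm_quantale)" "bot * x = (bot :: 'v::comm_quantale)"
  using mult_Sup_distrib[of x "{}"] by (simp_all add: mult.commute)

lemma v_groupI:
  assumes "group X"
    and "\<And>x. x \<in> carrier X \<Longrightarrow> 1 \<le> rel X x x"
    and "\<And>x y z. \<lbrakk>x \<in> carrier X; y \<in> carrier X; z \<in> carrier X\<rbrakk> \<Longrightarrow> rel X x y * rel X y z \<le> rel X x z"
    and "\<And>x y x' y'. \<lbrakk>x \<in> carrier X; x' \<in> carrier X; y \<in> carrier X; y' \<in> carrier X\<rbrakk>
      \<Longrightarrow> rel X x x' * rel X y y' \<le> rel X (x \<otimes>\<^bsub>X\<^esub> y) (x' \<otimes>\<^bsub>X\<^esub> y')"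
  shows "v_group X"
  using assms by (auto intro!: v_group.intro v_category.intro v_group_axioms.intro)

lemma v_group_cong:
  assumes "v_group X" and "carrier Y = carrier X" and "one Y = one X"
    and "\<And>x y. \<lbrakk>x \<in> carrier X; y \<in> carrier X\<rbrakk> \<Longrightarrow> x \<otimes>\<^bsub>Y\<^esub> y = x \<otimes>\<^bsub>X\<^esub> y"
    and "\<And>x y. \<lbrakk>x \<in> carrier X; y \<in> carrier X\<rbrakk> \<Longrightarrow> rel Y x y = rel X x y"
  shows "v_group Y"
proof -
  interpret X: v_group X by fact
  have "group Y"
    by (rule groupI) (use assms in \<open>auto simp: X.m_assoc intro: X.l_inv_ex\<close>)
  then show ?thesis
    by (rule v_groupI) (use assms in \<open>auto simp: X.unit_le X.comp_le X.mult_le\<close>)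
qed

lemma v_group_subgroup:
  assumes "v_group X" and "subgroup H X"
  shows "v_group (X\<lparr>carrier := H\<rparr>)"
proof -
  interpret X: v_group X by fact
  interpret H: subgroup H X by fact
  show ?thesis
    by (rule v_groupI) (auto simp: X.unit_le X.comp_le X.mult_le intro: H.subgroup_is_group X.is_group)
qed

lemma vhomI:
  assumes "f \<in> extensional (carrier X)"
    and "\<And>x. x \<in> carrier X \<Longrightarrow> f x \<in> carrier Y"
    and "\<And>x y. \<lbrakk>x \<in> carrier X; y \<in> carrier X\<rbrakk> \<Longrightarrow> f (x \<otimes>\<^bsub>X\<^esub> y) = f x \<otimes>\<^bsub>Y\<^esub> f y"
    and "\<And>x y. \<lbrakk>x \<in> carrier X; y \<in> carrier X\<rbrakk> \<Longrightarrow> rel X x y \<le> rel Y (f x) (f y)"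
  shows "f \<in> vhom X Y"
  using assms by (auto simp: vhom_def hom_def)

lemma vhomD:
  assumes "f \<in> vhom X Y"
  shows vhom_extensional: "f \<in> extensional (carrier X)"
    and vhom_closed: "x \<in> carrier X \<Longrightarrow> f x \<in> carrier Y"
    and vhom_mult: "\<lbrakk>x \<in> carrier X; y \<in> carrier X\<rbrakk> \<Longrightarrow> f (x \<otimes>\<^bsub>X\<^esub> y) = f x \<otimes>\<^bsub>Y\<^esub> f y"
    and vhom_rel: "\<lbrakk>x \<in> carrier X; y \<in> carrier X\<rbrakk> \<Longrightarrow> rel X x y \<le> rel Y (f x) (f y)"
  using assms by (auto simp: vhom_def hom_def)

lemma vhom_hom: "f \<in> vhom X Y \<Longrightarrow> f \<in> hom X Y"
  by (simp add: vhom_def)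

lemma vhom_one:
  assumes "f \<in> vhom X Y" "v_group X" "v_group Y"
  shows "f \<one>\<^bsub>X\<^esub> = \<one>\<^bsub>Y\<^esub>"
  using hom_one[of f X Y] assms by (simp add: vhom_hom v_group_def)

lemma vhom_eqI:
  assumes "f \<in> vhom X Y" "g \<in> vhom X Z" "\<And>x. x \<in> carrier X \<Longrightarrow> f x = g x"
  shows "f = g"
  using assms by (auto intro: extensionalityI dest: vhom_extensional)

lemma vhom_compose:
  assumes "f \<in> vhom X Y" "g \<in> vhom Y Z" "v_group X"
  shows "compose (carrier X) g f \<in> vhom X Z"
proof -
  interpret X: v_group X by fact
  show ?thesis
  proof (rule vhomI)
    fix x y assume "x \<in> carrier X" "y \<in> carrier X"
    then show "rel X x y \<le> rel Z (compose (carrier X) g f x) (compose (carrier X) g f y)"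
      using assms vhom_rel[OF assms(1), of x y] vhom_rel[OF assms(2), of "f x" "f y"]
      by (simp add: compose_eq vhom_closed)
  qed (use assms in \<open>auto simp: compose_eq vhom_closed vhom_mult\<close>)
qed

text \<open>Integrality puts \<open>rel Y\<close> at the unit equal to top, which bounds every value
  of \<open>rel X\<close>. These zero maps are the test maps that detect the kernel of a
  covering.\<close>

lemma vhom_const_one:
  assumes "(1::'v::comm_quantale) = Orderings.top" "v_group (X :: ('a, 'v) vgroup)" "v_group (Y :: ('b, 'v) vgroup)"
  shows "(\<lambda>x\<in>carrier X. \<one>\<^bsub>Y\<^esub>) \<in> vhom X Y"
proof -
  interpret X: v_group X by fact
  interpret Y: v_group Y by fact
  have "rel Y \<one>\<^bsub>Y\<^esub> \<one>\<^bsub>Y\<^esub> = Orderings.top"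
    using Y.unit_le[of "\<one>\<^bsub>Y\<^esub>"] assms(1) by (simp add: top_unique)
  then show ?thesis
    by (intro vhomI) auto
qed

lemma Ob_VGrp [simp]: "Ob VGrp = {X. v_group X}"
  and Hom_VGrp [simp]: "Hom VGrp = vhom"
  and Ident_VGrp [simp]: "Ident VGrp X = (\<lambda>x\<in>carrier X. x)"
  and Cmp_VGrp [simp]: "Cmp VGrp X Y Z g f = compose (carrier X) g f"
  by (simp_all add: VGrp_def)

lemma category_VGrp: "category VGrp"
proof
  fix X :: "('a, 'b) vgroup" assume "X \<in> Ob VGrp"
  then interpret v_group X by simp
  show "Ident VGrp X \<in> Hom VGrp X X"
    by (auto intro!: vhomI)
next
  fix X Y f assume "f \<in> Hom VGrp X (Y :: ('a, 'b) vgroup)"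
  then have f: "f \<in> vhom X Y" by simp
  then show "Cmp VGrp X Y Y (Ident VGrp Y) f = f"
    by (auto simp: compose_def vhom_closed intro!: extensionalityI[of _ "carrier X"] dest: vhom_extensional)
  from f show "Cmp VGrp X X Y f (Ident VGrp X) = f"
    by (auto simp: compose_def intro!: extensionalityI[of _ "carrier X"] dest: vhom_extensional)
next
  fix W X Y Z :: "('a, 'b) vgroup" and f g h
  assume "f \<in> Hom VGrp W X"
  then show "Cmp VGrp W Y Z h (Cmp VGrp W X Y g f) = Cmp VGrp W X Z (Cmp VGrp X Y Z h g) f"
    by (auto simp: compose_def vhom_closed)
qed (auto intro: vhom_compose)

lemma is_pullback_VGrp_ex1:
  fixes W P A B D :: "('u, 'v::comm_quantale) vgroup"
  assumes "is_pullback VGrp P q r A f B g D" "v_group W" "u \<in> vhom W A" "v \<in> vhom W B"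
    and "compose (carrier W) f u = compose (carrier W) g v"
  shows "\<exists>!w. w \<in> vhom W P \<and> compose (carrier W) q w = u \<and> compose (carrier W) r w = v"
proof -
  have "\<forall>W\<in>Ob VGrp. \<forall>u\<in>Hom VGrp W A. \<forall>v\<in>Hom VGrp W B.
      Cmp VGrp W A D f u = Cmp VGrp W B D g v \<longrightarrow>
      (\<exists>!w. w \<in> Hom VGrp W P \<and> Cmp VGrp W P A q w = u \<and> Cmp VGrp W P B r w = v)"
    using assms(1) unfolding is_pullback_def by (elim conjE)
  from this[unfolded Ob_VGrp Hom_VGrp Cmp_VGrp, THEN bspec, of W, THEN bspec, of u,
      THEN bspec, of v, THEN mp] show ?thesis
    using assms(2-5) by (simp only: mem_Collect_eq)
qed

section \<open>Transport of structure, pullbacks, and the V-group on the product with the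
  integers\<close>

lemma carrier_vg_copy [simp]: "carrier (vg_copy e X) = e ` carrier X"
  and one_vg_copy [simp]: "\<one>\<^bsub>vg_copy e X\<^esub> = e \<one>\<^bsub>X\<^esub>"
  by (simp_all add: vg_copy_def Let_def)

lemma mult_vg_copy:
  assumes "inj_on e (carrier X)" "x \<in> carrier X" "y \<in> carrier X"
  shows "e x \<otimes>\<^bsub>vg_copy e X\<^esub> e y = e (x \<otimes>\<^bsub>X\<^esub> y)"
  using assms by (simp add: vg_copy_def Let_def)

lemma rel_vg_copy:
  assumes "inj_on e (carrier X)" "x \<in> carrier X" "y \<in> carrier X"
  shows "rel (vg_copy e X) (e x) (e y) = rel X x y"
  using assms by (simp add: vg_copy_def Let_def)

lemma v_group_vg_copy:
  assumes "v_group X" and e: "inj_on e (carrier X)"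
  shows "v_group (vg_copy e X)"
proof -
  interpret X: v_group X by fact
  note [simp] = mult_vg_copy[OF e] rel_vg_copy[OF e]
  have "group (vg_copy e X)"
    by (rule groupI) (auto simp: X.m_assoc intro!: bexI[OF _ X.inv_closed])
  then show ?thesis
    by (rule v_groupI) (auto simp: X.unit_le X.comp_le X.mult_le)
qed

lemma carrier_vg_pullback [simp]:
    "carrier (vg_pullback X f Y g) = {(x, y). x \<in> carrier X \<and> y \<in> carrier Y \<and> f x = g y}"
  and mult_vg_pullback [simp]:
    "(x, y) \<otimes>\<^bsub>vg_pullback X f Y g\<^esub> (x', y') = (x \<otimes>\<^bsub>X\<^esub> x', y \<otimes>\<^bsub>Y\<^esub> y')"
  and one_vg_pullback [simp]: "\<one>\<^bsub>vg_pullback X f Y g\<^esub> = (\<one>\<^bsub>X\<^esub>, \<one>\<^bsub>Y\<^esub>)"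
  and rel_vg_pullback [simp]:
    "rel (vg_pullback X f Y g) (x, y) (x', y') = inf (rel X x x') (rel Y y y')"
  by (simp_all add: vg_pullback_def vgroup_of_def DirProd_def)

lemma v_group_vg_pullback:
  assumes "v_group X" "v_group Y" "group D" and f: "f \<in> hom X D" and g: "g \<in> hom Y D"
  shows "v_group (vg_pullback X f Y g)"
proof -
  interpret X: v_group X by fact
  interpret Y: v_group Y by fact
  interpret D: group D by fact
  interpret f: group_hom X D f using f by unfold_locales
  interpret g: group_hom Y D g using g by unfold_locales
  have "group (vg_pullback X f Y g)"
  proof (rule groupI)
    fix p assume "p \<in> carrier (vg_pullback X f Y g)"
    then show "\<exists>q\<in>carrier (vg_pullback X f Y g).
        q \<otimes>\<^bsub>vg_pullback X f Y g\<^esub> p = \<one>\<^bsub>vg_pullback X f Y g\<^esub>"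
      by (intro bexI[of _ "(inv\<^bsub>X\<^esub> fst p, inv\<^bsub>Y\<^esub> snd p)"]) auto
  qed (auto simp: X.m_assoc Y.m_assoc)
  then show ?thesis
  proof (rule v_groupI)
    fix p q r assume "p \<in> carrier (vg_pullback X f Y g)" "q \<in> carrier (vg_pullback X f Y g)"
      "r \<in> carrier (vg_pullback X f Y g)"
    then show "rel (vg_pullback X f Y g) p q * rel (vg_pullback X f Y g) q r \<le>
        rel (vg_pullback X f Y g) p r"
      by (auto intro: order_trans[OF quantale_mult_mono[OF inf_le1 inf_le1] X.comp_le]
          order_trans[OF quantale_mult_mono[OF inf_le2 inf_le2] Y.comp_le])
  next
    fix p q p' q' assume "p \<in> carrier (vg_pullback X f Y g)" "p' \<in> carrier (vg_pullback X f Y g)"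
      "q \<in> carrier (vg_pullback X f Y g)" "q' \<in> carrier (vg_pullback X f Y g)"
    then show "rel (vg_pullback X f Y g) p p' * rel (vg_pullback X f Y g) q q' \<le>
        rel (vg_pullback X f Y g) (p \<otimes>\<^bsub>vg_pullback X f Y g\<^esub> q) (p' \<otimes>\<^bsub>vg_pullback X f Y g\<^esub> q')"
      by (auto intro: order_trans[OF quantale_mult_mono[OF inf_le1 inf_le1] X.mult_le]
          order_trans[OF quantale_mult_mono[OF inf_le2 inf_le2] Y.mult_le])
  qed (auto simp: X.unit_le Y.unit_le)
qed

lemma carrier_int_ext [simp]: "carrier (int_ext X) = UNIV \<times> carrier X"
  and mult_int_ext [simp]: "(z, x) \<otimes>\<^bsub>int_ext X\<^esub> (z', x') = (z + z', x \<otimes>\<^bsub>X\<^esub> x')"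
  and one_int_ext [simp]: "\<one>\<^bsub>int_ext X\<^esub> = (0, \<one>\<^bsub>X\<^esub>)"
  and rel_int_ext [simp]: "rel (int_ext X) (z, x) (z', x') =
    (if z < z' then rel X x x' else if z = z' \<and> x = x' then Orderings.top else bot)"
  by (simp_all add: int_ext_def vgroup_of_def DirProd_def)

lemma v_group_int_ext:
  assumes "(1::'v::comm_quantale) = Orderings.top" "v_group (X :: ('a, 'v) vgroup)"
  shows "v_group (int_ext X)"
proof -
  interpret X: v_group X by fact
  note top1 [simp] = assms(1)[symmetric]
  have rel1: "rel X x x = 1" if "x \<in> carrier X" for x
    using X.unit_le[OF that] assms(1) by (metis top_unique)
  \<comment> \<open>Needed when one of the two pairs lies on a single level: unless its factor is
    bot, its elements are equal and the factor is the unit, so that the inequality is a translation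
    of the other pair.\<close>
  have translate: "rel X x y \<le> rel X (x \<otimes>\<^bsub>X\<^esub> z) (y \<otimes>\<^bsub>X\<^esub> z)"
      "rel X x y \<le> rel X (z \<otimes>\<^bsub>X\<^esub> x) (z \<otimes>\<^bsub>X\<^esub> y)"
    if "x \<in> carrier X" "y \<in> carrier X" "z \<in> carrier X" for x y z
    using X.mult_le[of x y z z] X.mult_le[of z z x y] that by (simp_all add: rel1)
  have "group (int_ext X)"
    by (rule groupI)
      (auto simp: X.m_assoc intro!: exI[of _ "- z" for z] bexI[OF _ X.inv_closed])
  then show ?thesis
  proof (rule v_groupI)
    fix p q r assume "p \<in> carrier (int_ext X)" "q \<in> carrier (int_ext X)" "r \<in> carrier (int_ext X)"
    then show "rel (int_ext X) p q * rel (int_ext X) q r \<le> rel (int_ext X) p r"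
      by (cases p; cases q; cases r) (auto simp: X.comp_le quantale_mult_bot)
  next
    fix p q p' q' assume "p \<in> carrier (int_ext X)" "p' \<in> carrier (int_ext X)"
      "q \<in> carrier (int_ext X)" "q' \<in> carrier (int_ext X)"
    then show "rel (int_ext X) p p' * rel (int_ext X) q q' \<le>
        rel (int_ext X) (p \<otimes>\<^bsub>int_ext X\<^esub> q) (p' \<otimes>\<^bsub>int_ext X\<^esub> q')"
      using X.mult_le[of "snd p" "snd p'" "snd q" "snd q'"]
      by (cases p; cases q; cases p'; cases q')
        (auto simp: X.mult_le quantale_mult_bot rel1 translate)
  qed (auto)
qed

section \<open>The kernel of the separated reflection, and the reflection of a separated
  V-group\<close>

lemma subgroup_sep_kernel:
  assumes "v_group X"
  shows "subgroup (sep_kernel X) X"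
proof -
  interpret X: v_group X by fact
  have mult: "1 \<le> rel X (x \<otimes>\<^bsub>X\<^esub> y) (x' \<otimes>\<^bsub>X\<^esub> y')"
    if "1 \<le> rel X x x'" "1 \<le> rel X y y'" "x \<in> carrier X" "x' \<in> carrier X" "y \<in> carrier X" "y' \<in> carrier X"
    for x x' y y'
    using quantale_mult_mono[OF that(1,2)] X.mult_le[OF that(3-6)] by simp
  show ?thesis
  proof
    fix x y assume "x \<in> sep_kernel X" "y \<in> sep_kernel X"
    then show "x \<otimes>\<^bsub>X\<^esub> y \<in> sep_kernel X"
      using mult[of "\<one>\<^bsub>X\<^esub>" x "\<one>\<^bsub>X\<^esub>" y] mult[of x "\<one>\<^bsub>X\<^esub>" y "\<one>\<^bsub>X\<^esub>"] by (auto simp: sep_kernel_def)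
  next
    fix x assume "x \<in> sep_kernel X"
    \<comment> \<open>Translating by the inverse of \<open>x\<close> carries the pair (1, x) to (inv
      x, 1), so the two conditions exchange their roles.\<close>
    then show "inv\<^bsub>X\<^esub> x \<in> sep_kernel X"
      using mult[of "\<one>\<^bsub>X\<^esub>" x "inv\<^bsub>X\<^esub> x" "inv\<^bsub>X\<^esub> x"] mult[of x "\<one>\<^bsub>X\<^esub>" "inv\<^bsub>X\<^esub> x" "inv\<^bsub>X\<^esub> x"]
      by (auto simp: sep_kernel_def X.unit_le)
  qed (auto simp: sep_kernel_def X.unit_le)
qed

lemma sep_unit_sep_kernel:
  assumes "v_group X" and "n \<in> sep_kernel X"
  shows "sep_unit X n = sep_unit X \<one>\<^bsub>X\<^esub>"
proof -
  interpret X: v_group X by fact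
  have "sep_kernel X #>\<^bsub>X\<^esub> n = sep_kernel X #>\<^bsub>X\<^esub> \<one>\<^bsub>X\<^esub>"
    by (metis X.coset_join2 X.one_closed assms(2) subgroup.mem_carrier subgroup.one_closed
        subgroup_sep_kernel[OF assms(1)])
  moreover have "n \<in> carrier X" using assms(2) by (simp add: sep_kernel_def)
  ultimately show ?thesis by (simp add: sep_unit_def)
qed

lemma separated_iff_sep_kernel:
  assumes "v_group X"
  shows "separated X \<longleftrightarrow> sep_kernel X = {\<one>\<^bsub>X\<^esub>}"
proof
  interpret X: v_group X by fact
  show "sep_kernel X = {\<one>\<^bsub>X\<^esub>}" if "separated X"
    using that X.unit_le by (fastforce simp: separated_def sep_kernel_def)
  show "separated X" if N: "sep_kernel X = {\<one>\<^bsub>X\<^esub>}"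
    unfolding separated_def
  proof (intro ballI impI, elim conjE)
    fix x y assume x: "x \<in> carrier X" and y: "y \<in> carrier X"
      and xy: "1 \<le> rel X x y" "1 \<le> rel X y x"
    \<comment> \<open>Prepares a translation by the inverse of \<open>x\<close>, which moves the
      pair (x, y) to (1, y - x) in additive notation and so reduces separatedness to the
      kernel.\<close>
    have 1: "1 * 1 \<le> rel X u v * rel X (inv\<^bsub>X\<^esub> x) (inv\<^bsub>X\<^esub> x)" if "1 \<le> rel X u v" for u v
      by (rule quantale_mult_mono) (use that x X.unit_le in auto)
    have "y \<otimes>\<^bsub>X\<^esub> inv\<^bsub>X\<^esub> x \<in> sep_kernel X"
      using 1[OF xy(1)] X.mult_le[OF x y, of "inv\<^bsub>X\<^esub> x" "inv\<^bsub>X\<^esub> x"]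
        1[OF xy(2)] X.mult_le[OF y x, of "inv\<^bsub>X\<^esub> x" "inv\<^bsub>X\<^esub> x"] x y
      by (auto simp: sep_kernel_def)
    then have "y \<otimes>\<^bsub>X\<^esub> inv\<^bsub>X\<^esub> x = \<one>\<^bsub>X\<^esub>" using N by simp
    then show "x = y" using x y by (metis X.inv_equality X.inv_inv X.inv_closed)
  qed
qed

text \<open>The kernel is trivial, so cosets are singletons and choosing representatives undoes the
  quotient. The result is stated component by component on the carrier, because off the carrier the
  operations of the two records may differ.\<close>

lemma
  assumes "v_group X" and "separated X"
  shows carrier_sep_refl: "carrier (sep_refl X) = carrier X"
    and one_sep_refl: "\<one>\<^bsub>sep_refl X\<^esub> = \<one>\<^bsub>X\<^esub>"
    and mult_sep_refl: "\<lbrakk>x \<in> carrier X; y \<in> carrier X\<rbrakk> \<Longrightarrow> x \<otimes>\<^bsub>sep_refl X\<^esub> y = x \<otimes>\<^bsub>X\<^esub> y"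
    and rel_sep_refl: "\<lbrakk>x \<in> carrier X; y \<in> carrier X\<rbrakk> \<Longrightarrow> rel (sep_refl X) x y = rel X x y"
    and sep_unit_separated: "sep_unit X = (\<lambda>x\<in>carrier X. x)"
proof -
  interpret X: v_group X by fact
  have N: "sep_kernel X = {\<one>\<^bsub>X\<^esub>}" using assms by (simp add: separated_iff_sep_kernel)
  have coset[simp]: "sep_kernel X #>\<^bsub>X\<^esub> x = {x}" if "x \<in> carrier X" for x
    using that by (auto simp: N r_coset_def)
  have rep[simp]: "coset_rep {x} = x" for x :: 'a
    by (simp add: coset_rep_def)
  have car: "carrier (sep_quot X) = (\<lambda>x. {x}) ` carrier X"
    by (auto simp: sep_quot_def vgroup_of_def FactGroup_def RCOSETS_def image_def)
  have inj: "inj_on coset_rep (carrier (sep_quot X))"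
    by (auto simp: car inj_on_def)
  have mem: "{x} \<in> carrier (sep_quot X)" if "x \<in> carrier X" for x
    using that by (simp add: car)
  show "carrier (sep_refl X) = carrier X"
    by (auto simp: sep_refl_def car image_image)
  show "\<one>\<^bsub>sep_refl X\<^esub> = \<one>\<^bsub>X\<^esub>"
    by (simp add: sep_refl_def sep_quot_def vgroup_of_def FactGroup_def N)
  show "x \<otimes>\<^bsub>sep_refl X\<^esub> y = x \<otimes>\<^bsub>X\<^esub> y" if "x \<in> carrier X" "y \<in> carrier X" for x y
    using mult_vg_copy[OF inj mem[OF that(1)] mem[OF that(2)]] that
    by (simp add: sep_refl_def) (simp add: sep_quot_def vgroup_of_def FactGroup_def set_mult_def)
  show "rel (sep_refl X) x y = rel X x y" if "x \<in> carrier X" "y \<in> carrier X" for x y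
  proof -
    have "x\<^sub>1 \<in> carrier X \<and> x\<^sub>2 \<in> carrier X \<and>
        sep_kernel X #>\<^bsub>X\<^esub> x\<^sub>1 = {x} \<and> sep_kernel X #>\<^bsub>X\<^esub> x\<^sub>2 = {y} \<longleftrightarrow> x\<^sub>1 = x \<and> x\<^sub>2 = y" for x\<^sub>1 x\<^sub>2
      using that by auto
    then show ?thesis
      using rel_vg_copy[OF inj mem[OF that(1)] mem[OF that(2)]]
      by (simp add: sep_refl_def) (simp add: sep_quot_def vgroup_of_def)
  qed
  show "sep_unit X = (\<lambda>x\<in>carrier X. x)"
    by (auto simp: sep_unit_def)
qed

section \<open>Trivial coverings and coverings\<close>

lemma trivial_covering_if_separated:
  assumes "v_group P" "v_group E" "separated P" "separated E" and q: "q \<in> vhom P E"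
  shows "trivial_covering P E q"
proof -
  note P [simp] = carrier_sep_refl[OF assms(1,3)] mult_sep_refl[OF assms(1,3)]
    rel_sep_refl[OF assms(1,3)] sep_unit_separated[OF assms(1,3)]
  note E [simp] = carrier_sep_refl[OF assms(2,4)] mult_sep_refl[OF assms(2,4)]
    rel_sep_refl[OF assms(2,4)] sep_unit_separated[OF assms(2,4)]
  interpret P: v_group P by fact
  interpret E: v_group E by fact
  have vg: "v_group (sep_refl P)" "v_group (sep_refl E)"
    by (rule v_group_cong[OF assms(1)] v_group_cong[OF assms(2)];
        simp add: one_sep_refl[OF assms(1,3)] one_sep_refl[OF assms(2,4)])+
  have q': "q \<in> vhom (sep_refl P) (sep_refl E)"
    using q by (intro vhomI) (auto dest: vhom_extensional simp: vhom_closed vhom_mult vhom_rel)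
  have "h = q" if "h \<in> vhom (sep_refl P) (sep_refl E)"
    "compose (carrier P) h (sep_unit P) = compose (carrier P) (sep_unit E) q" for h
  proof (rule vhom_eqI[OF that(1) q'])
    fix x assume "x \<in> carrier (sep_refl P)"
    then show "h x = q x"
      using fun_cong[OF that(2), of x] q by (simp add: compose_eq vhom_closed)
  qed
  moreover have sq: "compose (carrier P) q (sep_unit P) = compose (carrier P) (sep_unit E) q"
    using q by (auto simp: compose_def vhom_closed)
  ultimately have map: "sep_refl_map P E q = q"
    unfolding sep_refl_map_def using q' by blast
  have unit: "sep_unit P \<in> vhom P (sep_refl P)" "sep_unit E \<in> vhom E (sep_refl E)"
    by (auto intro!: vhomI)
  have "is_pullback VGrp P q (sep_unit P) E (sep_unit E) (sep_refl P) q (sep_refl E)"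
    unfolding is_pullback_def
  proof (intro conjI ballI impI)
    fix W u v assume "W \<in> Ob VGrp" and u: "u \<in> Hom VGrp W E" and v: "v \<in> Hom VGrp W (sep_refl P)"
      and uv: "Cmp VGrp W E (sep_refl E) (sep_unit E) u = Cmp VGrp W (sep_refl P) (sep_refl E) q v"
    \<comment> \<open>\<open>P\<close> and \<open>sep_refl P\<close> are different records that
      agree on the carrier, so \<open>v\<close> has to be read again as a map into \<open>P\<close>;
      it is then the only possible mediating map.\<close>
    have v': "v \<in> vhom W P"
    proof (rule vhomI)
      fix x y assume xy: "x \<in> carrier W" "y \<in> carrier W"
      have v: "v \<in> vhom W (sep_refl P)" using v by simp
      then have "v x \<in> carrier P" "v y \<in> carrier P" using xy by (auto dest: vhom_closed)
      then show "v (x \<otimes>\<^bsub>W\<^esub> y) = v x \<otimes>\<^bsub>P\<^esub> v y" "rel W x y \<le> rel P (v x) (v y)"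
        using vhom_mult[OF v xy] vhom_rel[OF v xy] by simp_all
    qed (use v in \<open>auto dest: vhom_extensional vhom_closed\<close>)
    have "q (v x) = u x" if "x \<in> carrier W" for x
      using fun_cong[OF uv, of x] that u by (simp add: compose_eq vhom_closed)
    then have qv: "compose (carrier W) q v = u"
      using u by (auto intro!: extensionalityI[of _ "carrier W"] simp: compose_eq dest: vhom_extensional)
    have id: "compose (carrier W) (sep_unit P) w = w" if "w \<in> vhom W P" for w
      using that by (auto intro!: extensionalityI[of _ "carrier W"] simp: compose_eq vhom_closed
        dest: vhom_extensional)
    show "\<exists>!w. w \<in> Hom VGrp W P \<and> Cmp VGrp W P E q w = u \<and> Cmp VGrp W P (sep_refl P) (sep_unit P) w = v"
    proof (rule ex1I[of _ v])
      show "v \<in> Hom VGrp W P \<and> Cmp VGrp W P E q v = u \<and> Cmp VGrp W P (sep_refl P) (sep_unit P) v = v"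
        using v' qv id[OF v'] by (simp del: P)
      show "w = v" if "w \<in> Hom VGrp W P \<and> Cmp VGrp W P E q w = u \<and>
          Cmp VGrp W P (sep_refl P) (sep_unit P) w = v" for w
        using that id[of w] by (simp del: P)
    qed
  qed (use assms vg q' unit sq in simp_all)
  then show ?thesis
    using q by (simp add: trivial_covering_def map)
qed

text \<open>On the subgroup \<open>K\<close> of elements killed both by the unit and by
  \<open>q\<close>, the inclusion and the zero map into \<open>P\<close> have the same composites
  with both projections. The uniqueness half of the pullback property identifies them.\<close>

lemma trivial_covering_kernel:
  assumes "(1::'v::comm_quantale) = Orderings.top" and tc: "trivial_covering P (E :: ('a, 'v) vgroup) q"
    and n: "n \<in> sep_kernel P" "q n = \<one>\<^bsub>E\<^esub>"
  shows "n = \<one>\<^bsub>P\<^esub>"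
proof -
  have pb': "is_pullback VGrp P q (sep_unit P) E (sep_unit E) (sep_refl P) (sep_refl_map P E q) (sep_refl E)"
    using tc by (simp add: trivial_covering_def)
  note pb = this[unfolded is_pullback_def, simplified]
  from pb interpret P: v_group P by simp
  from pb interpret E: v_group E by simp
  from pb have q: "q \<in> vhom P E" by simp
  then interpret q: group_hom P E q
    by unfold_locales (rule vhom_hom)
  define K where "K = sep_kernel P \<inter> kernel P E q"
  have K: "q x = \<one>\<^bsub>E\<^esub>" "x \<in> sep_kernel P" if "x \<in> K" for x
    using that by (simp_all add: K_def kernel_def)
  have nK: "n \<in> K" using n by (simp add: K_def kernel_def sep_kernel_def)
  have "subgroup K P"
    unfolding K_def
    by (intro P.subgroups_Inter_pair subgroup_sep_kernel q.subgroup_kernel) unfold_locales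
  then interpret K: subgroup K P .
  let ?W = "P\<lparr>carrier := K\<rparr>"
  have W: "v_group ?W" by (rule v_group_subgroup) (unfold_locales)
  have i: "(\<lambda>x\<in>K. x) \<in> vhom ?W P" by (rule vhomI) auto
  have c: "(\<lambda>x\<in>K. \<one>\<^bsub>P\<^esub>) \<in> vhom ?W P" using vhom_const_one[OF assms(1) W P.v_group_axioms] by simp
  have unit: "sep_unit P \<in> vhom P (sep_refl P)" and X: "v_group (sep_refl P)" using pb by auto
  let ?u = "compose K q (\<lambda>x\<in>K. x)" and ?v = "compose K (sep_unit P) (\<lambda>x\<in>K. x)"
  have uc: "compose K q (\<lambda>x\<in>K. \<one>\<^bsub>P\<^esub>) = ?u"
    unfolding compose_def by (rule restrict_ext) (simp add: K)
  have vc: "compose K (sep_unit P) (\<lambda>x\<in>K. \<one>\<^bsub>P\<^esub>) = ?v"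
    unfolding compose_def
  proof (rule restrict_ext)
    fix x assume "x \<in> K"
    then show "sep_unit P ((\<lambda>x\<in>K. \<one>\<^bsub>P\<^esub>) x) = sep_unit P ((\<lambda>x\<in>K. x) x)"
      using sep_unit_sep_kernel[OF P.v_group_axioms K(2)[OF \<open>x \<in> K\<close>]] by simp
  qed
  have carW: "carrier ?W = K" by simp
  have u: "?u \<in> vhom ?W E" and v: "?v \<in> vhom ?W (sep_refl P)"
    using vhom_compose[OF i q W] vhom_compose[OF i unit W] by simp_all
  have uv: "compose K (sep_unit E) ?u = compose K (sep_refl_map P E q) ?v"
  proof -
    have "compose (carrier P) (sep_unit E) q = compose (carrier P) (sep_refl_map P E q) (sep_unit P)"
      using pb by simp
    from fun_cong[OF this] have "sep_unit E (q x) = sep_refl_map P E q (sep_unit P x)" if "x \<in> K" for x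
      using K.mem_carrier[OF that] by (metis compose_eq)
    then show ?thesis
      unfolding compose_def by (intro restrict_ext) simp
  qed
  have "\<exists>!w. w \<in> vhom ?W P \<and> compose K q w = ?u \<and> compose K (sep_unit P) w = ?v"
    by (rule is_pullback_VGrp_ex1[OF pb' W u v, unfolded carW, OF uv])
  then have "(\<lambda>x\<in>K. x) = (\<lambda>x\<in>K. \<one>\<^bsub>P\<^esub>)"
    using i c uc vc by blast
  then show ?thesis using nK by (metis restrict_apply')
qed

text \<open>Here the existence half is used: the zero map to \<open>E\<close> and the inclusion of
  \<open>K\<close> in \<open>Z\<close> induce a map \<open>w\<close> from \<open>K\<close> to
  \<open>P\<close>. It preserves the structure and the unit, so \<open>w n\<close> satisfies the
  hypotheses for the trivial covering \<open>q\<close> and is the unit; as \<open>r\<close> after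
  \<open>w\<close> is the inclusion, so is \<open>n\<close>.\<close>

lemma covering_kernel:
  assumes "(1::'v::comm_quantale) = Orderings.top" and cov: "covering Z (X :: ('a, 'v) vgroup) g"
    and n: "n \<in> sep_kernel Z" "g n = \<one>\<^bsub>X\<^esub>"
  shows "n = \<one>\<^bsub>Z\<^esub>"
proof -
  obtain E p P q r where pb': "is_pullback VGrp P q r E p Z g X" and tc: "trivial_covering P E q"
    using cov by (auto simp: covering_def)
  note pb = pb'[unfolded is_pullback_def, simplified]
  from pb interpret Z: v_group Z by simp
  from pb interpret X: v_group X by simp
  from pb interpret E: v_group E by simp
  from pb interpret P: v_group P by simp
  from pb have g: "g \<in> vhom Z X" and p: "p \<in> vhom E X" and r: "r \<in> vhom P Z" by auto
  then interpret g: group_hom Z X g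
    by unfold_locales (auto dest: vhom_hom)
  define K where "K = sep_kernel Z \<inter> kernel Z X g"
  have K: "g x = \<one>\<^bsub>X\<^esub>" if "x \<in> K" for x
    using that by (simp add: K_def kernel_def)
  have nK: "n \<in> K" using n by (simp add: K_def kernel_def sep_kernel_def)
  have "subgroup K Z"
    unfolding K_def
    by (intro Z.subgroups_Inter_pair subgroup_sep_kernel g.subgroup_kernel) unfold_locales
  then interpret K: subgroup K Z .
  let ?W = "Z\<lparr>carrier := K\<rparr>"
  have W: "v_group ?W" by (rule v_group_subgroup) (unfold_locales)
  have i: "(\<lambda>x\<in>K. x) \<in> vhom ?W Z" by (rule vhomI) auto
  have c: "(\<lambda>x\<in>K. \<one>\<^bsub>E\<^esub>) \<in> vhom ?W E" using vhom_const_one[OF assms(1) W E.v_group_axioms] by simp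
  have "compose K p (\<lambda>x\<in>K. \<one>\<^bsub>E\<^esub>) = compose K g (\<lambda>x\<in>K. x)"
    unfolding compose_def
    by (rule restrict_ext)
      (simp add: K vhom_one[OF p E.v_group_axioms X.v_group_axioms])
  then have "\<exists>!w. w \<in> vhom ?W P \<and> compose K q w = (\<lambda>x\<in>K. \<one>\<^bsub>E\<^esub>) \<and> compose K r w = (\<lambda>x\<in>K. x)"
    using is_pullback_VGrp_ex1[OF pb' W] i c by simp
  then obtain w where w: "w \<in> vhom ?W P" and qw: "compose K q w = (\<lambda>x\<in>K. \<one>\<^bsub>E\<^esub>)"
    and rw: "compose K r w = (\<lambda>x\<in>K. x)" by blast
  have w1: "w \<one>\<^bsub>Z\<^esub> = \<one>\<^bsub>P\<^esub>" using vhom_one[OF w W P.v_group_axioms] by simp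
  have "w n \<in> sep_kernel P"
    using vhom_closed[OF w, of n] vhom_rel[OF w, of n "\<one>\<^bsub>Z\<^esub>"] vhom_rel[OF w, of "\<one>\<^bsub>Z\<^esub>" n] nK n(1)
    by (auto simp: sep_kernel_def w1 intro: order_trans)
  moreover have "q (w n) = \<one>\<^bsub>E\<^esub>" using fun_cong[OF qw, of n] nK by (simp add: compose_eq)
  ultimately have "w n = \<one>\<^bsub>P\<^esub>" by (rule trivial_covering_kernel[OF assms(1) tc])
  then have "r \<one>\<^bsub>P\<^esub> = n" using fun_cong[OF rw, of n] nK by (simp add: compose_eq)
  then show ?thesis using vhom_one[OF r P.v_group_axioms Z.v_group_axioms] by simp
qed

section \<open>The pullback functor and its left adjoint\<close>

lemma compose_cong:
  "(\<And>x. x \<in> A \<Longrightarrow> g (f x) = g' (f' x)) \<Longrightarrow> compose A g f = compose A g' f'"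
  unfolding compose_def by (rule restrict_ext)

lemma compose_eqI:
  "h \<in> extensional A \<Longrightarrow> (\<And>x. x \<in> A \<Longrightarrow> g (f x) = h x) \<Longrightarrow> compose A g f = h"
  by (rule extensionalityI) (auto simp: compose_eq)

lemma compose_eqD: "compose A g f = h \<Longrightarrow> x \<in> A \<Longrightarrow> g (f x) = h x"
  by (metis compose_eq)

lemma Ob_slice_VGrp [simp]: "(Z, g) \<in> Ob (slice VGrp B) \<longleftrightarrow> v_group Z \<and> g \<in> vhom Z B"
  and Hom_slice_VGrp [simp]: "h \<in> Hom (slice VGrp B) (Z, g) (Z', g') \<longleftrightarrow>
    h \<in> vhom Z Z' \<and> compose (carrier Z) g' h = g"
  and Ident_slice_VGrp [simp]: "Ident (slice VGrp B) (Z, g) = (\<lambda>z\<in>carrier Z. z)"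
  and Cmp_slice_VGrp [simp]:
    "Cmp (slice VGrp B) (Z, g) (Z', g') (Z'', g'') k h = compose (carrier Z) k h"
  by (simp_all add: slice_def)

text \<open>Objects of \<open>VGrp\<close> have their carrier in the universe \<open>'u\<close>, so
  elements of the product with the integers are coded by \<open>e\<close> and elements of pullbacks
  by \<open>j\<close>.\<close>

locale int_cover =
  fixes X Y :: "('u, 'v::comm_quantale) vgroup"
    and e :: "int \<times> 'u \<Rightarrow> 'u"
    and f :: "'u \<Rightarrow> 'u"
    and j :: "'u \<times> 'u \<Rightarrow> 'u"
  assumes integral: "(1::'v) = Orderings.top"
    and nontrivial: "(bot::'v) \<noteq> Orderings.top"
    and X: "v_group X"
    and e: "inj_on e (carrier (int_ext X))"
    and Y_def: "Y = vg_copy e (int_ext X)"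
    and f_ext: "f \<in> extensional (carrier Y)"
    and f_e [simp]: "x \<in> carrier X \<Longrightarrow> f (e (z, x)) = x"
    and j: "inj j"
begin

lemma le_rel_refl:
  fixes A :: "('a, 'v) vgroup"
  assumes "v_group A" "x \<in> carrier A"
  shows "r \<le> rel A x x"
proof -
  interpret A: v_group A by fact
  have "rel A x x = Orderings.top" using A.unit_le[OF assms(2)] integral by (simp add: top_unique)
  then show ?thesis by simp
qed

lemma v_group_Y: "v_group Y"
  unfolding Y_def by (intro v_group_vg_copy v_group_int_ext integral X e)

sublocale X: v_group X by (rule X)
sublocale Y: v_group Y by (rule v_group_Y)

lemma e_in_Y [simp]: "x \<in> carrier X \<Longrightarrow> e (z, x) \<in> carrier Y"
  by (simp add: Y_def)

lemma Y_cases: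
  assumes "y \<in> carrier Y"
  obtains z where "y = e (z, f y)" "f y \<in> carrier X"
  using assms by (auto simp: Y_def)

lemma f_in_X [simp]: "y \<in> carrier Y \<Longrightarrow> f y \<in> carrier X"
  by (auto elim: Y_cases)

lemma e_mult [simp]: "\<lbrakk>x \<in> carrier X; x' \<in> carrier X\<rbrakk>
    \<Longrightarrow> e (z, x) \<otimes>\<^bsub>Y\<^esub> e (z', x') = e (z + z', x \<otimes>\<^bsub>X\<^esub> x')"
  unfolding Y_def by (subst mult_vg_copy[OF e]) auto

lemma one_Y: "\<one>\<^bsub>Y\<^esub> = e (0, \<one>\<^bsub>X\<^esub>)"
  unfolding Y_def by simp

lemma e_rel: "\<lbrakk>x \<in> carrier X; x' \<in> carrier X\<rbrakk> \<Longrightarrow> rel Y (e (z, x)) (e (z', x')) =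
    (if z < z' then rel X x x' else if z = z' \<and> x = x' then Orderings.top else bot)"
  unfolding Y_def by (subst rel_vg_copy[OF e]) auto

text \<open>Only equal elements of one level need an argument: there \<open>rel Y\<close> is top,
  and so is \<open>rel X x x\<close> by integrality.\<close>

lemma rel_Y_le: "\<lbrakk>y \<in> carrier Y; y' \<in> carrier Y\<rbrakk> \<Longrightarrow> rel Y y y' \<le> rel X (f y) (f y')"
  by (elim Y_cases) (metis bot_least e_rel le_rel_refl order_refl X)

lemma f_hom: "f \<in> vhom Y X"
proof (rule vhomI)
  fix y y' assume "y \<in> carrier Y" "y' \<in> carrier Y"
  then show "f (y \<otimes>\<^bsub>Y\<^esub> y') = f y \<otimes>\<^bsub>X\<^esub> f y'"
    by (elim Y_cases) (metis X.m_closed e_mult f_e)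
qed (auto simp: f_ext rel_Y_le)

text \<open>Both values lie above the unit, which is top and hence not bot. So neither level exceeds
  the other, and on a single level only equal elements have a value different from bot.\<close>

lemma separated_Y: "separated Y"
  unfolding separated_def
proof (intro ballI impI)
  fix y y' assume *: "y \<in> carrier Y" "y' \<in> carrier Y" "1 \<le> rel Y y y' \<and> 1 \<le> rel Y y' y"
  from *(1) obtain z where y: "y = e (z, f y)" "f y \<in> carrier X" by (rule Y_cases)
  from *(2) obtain z' where y': "y' = e (z', f y')" "f y' \<in> carrier X" by (rule Y_cases)
  have "\<not> Orderings.top \<le> (bot::'v)" using nontrivial by (metis top_unique)
  then have "z = z'" "z = z' \<longrightarrow> f y = f y'"
    using *(3) e_rel[OF y(2) y'(2), of z z'] e_rel[OF y'(2) y(2), of z' z] integral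
    by (auto simp flip: y(1) y'(1) split: if_splits)
  then show "y = y'" using y y' by metis
qed

section \<open>The chosen pullbacks along \<open>f\<close>\<close>

definition PB :: "('u, 'v) vgroup \<Rightarrow> ('u \<Rightarrow> 'u) \<Rightarrow> ('u, 'v) vgroup" where
  "PB Z g = vg_copy j (vg_pullback Y f Z g)"

abbreviation (input) "unj \<equiv> inv_into UNIV j"

lemma unj_j [simp]: "unj (j p) = p"
  by (rule inv_f_f[OF j])

lemma j_eq_iff [simp]: "j p = j q \<longleftrightarrow> p = q"
  using j by (auto dest: injD)

lemma j_in_PB [simp]: "j (y, z) \<in> carrier (PB Z g) \<longleftrightarrow> y \<in> carrier Y \<and> z \<in> carrier Z \<and> f y = g z"
  by (auto simp: PB_def image_iff)

lemma PB_cases: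
  assumes "w \<in> carrier (PB Z g)"
  obtains y z where "w = j (y, z)" "y \<in> carrier Y" "z \<in> carrier Z" "f y = g z"
  using assms by (auto simp: PB_def)

lemma inj_on_j [simp]: "inj_on j S"
  using j by (rule inj_on_subset) simp

lemma PB_mult [simp]:
  "\<lbrakk>y \<in> carrier Y; z \<in> carrier Z; f y = g z; y' \<in> carrier Y; z' \<in> carrier Z; f y' = g z'\<rbrakk>
    \<Longrightarrow> j (y, z) \<otimes>\<^bsub>PB Z g\<^esub> j (y', z') = j (y \<otimes>\<^bsub>Y\<^esub> y', z \<otimes>\<^bsub>Z\<^esub> z')"
  unfolding PB_def by (subst mult_vg_copy) auto

lemma PB_rel [simp]:
  "\<lbrakk>y \<in> carrier Y; z \<in> carrier Z; f y = g z; y' \<in> carrier Y; z' \<in> carrier Z; f y' = g z'\<rbrakk>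
    \<Longrightarrow> rel (PB Z g) (j (y, z)) (j (y', z')) = inf (rel Y y y') (rel Z z z')"
  unfolding PB_def by (subst rel_vg_copy) auto

lemma PB_one: "\<one>\<^bsub>PB Z g\<^esub> = j (\<one>\<^bsub>Y\<^esub>, \<one>\<^bsub>Z\<^esub>)"
  by (simp add: PB_def)

lemma v_group_PB:
  assumes "v_group Z" "g \<in> vhom Z X"
  shows "v_group (PB Z g)"
  unfolding PB_def
  by (rule v_group_vg_copy[OF v_group_vg_pullback[of _ _ X]])
    (use assms in \<open>auto intro: vhom_hom f_hom v_group_Y X.is_group\<close>)

definition p1 :: "('u, 'v) vgroup \<Rightarrow> ('u \<Rightarrow> 'u) \<Rightarrow> 'u \<Rightarrow> 'u" where
  "p1 Z g = (\<lambda>w\<in>carrier (PB Z g). fst (unj w))"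

definition p2 :: "('u, 'v) vgroup \<Rightarrow> ('u \<Rightarrow> 'u) \<Rightarrow> 'u \<Rightarrow> 'u" where
  "p2 Z g = (\<lambda>w\<in>carrier (PB Z g). snd (unj w))"

lemma p1_j [simp]: "\<lbrakk>y \<in> carrier Y; z \<in> carrier Z; f y = g z\<rbrakk> \<Longrightarrow> p1 Z g (j (y, z)) = y"
  and p2_j [simp]: "\<lbrakk>y \<in> carrier Y; z \<in> carrier Z; f y = g z\<rbrakk> \<Longrightarrow> p2 Z g (j (y, z)) = z"
  by (simp_all add: p1_def p2_def)

lemma PB_p: "w \<in> carrier (PB Z g) \<Longrightarrow> w = j (p1 Z g w, p2 Z g w)"
  and p1_in [simp]: "w \<in> carrier (PB Z g) \<Longrightarrow> p1 Z g w \<in> carrier Y"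
  and p2_in [simp]: "w \<in> carrier (PB Z g) \<Longrightarrow> p2 Z g w \<in> carrier Z"
  and PB_commutes: "w \<in> carrier (PB Z g) \<Longrightarrow> f (p1 Z g w) = g (p2 Z g w)"
  by (auto elim!: PB_cases)

lemma p1_hom:
  assumes "v_group Z" "g \<in> vhom Z X"
  shows "p1 Z g \<in> vhom (PB Z g) Y"
proof (rule vhomI)
  interpret Z: v_group Z by fact
  fix w w' assume "w \<in> carrier (PB Z g)" "w' \<in> carrier (PB Z g)"
  then show "p1 Z g (w \<otimes>\<^bsub>PB Z g\<^esub> w') = p1 Z g w \<otimes>\<^bsub>Y\<^esub> p1 Z g w'"
    "rel (PB Z g) w w' \<le> rel Y (p1 Z g w) (p1 Z g w')"
    using vhom_mult[OF assms(2)] vhom_mult[OF f_hom] by (auto elim!: PB_cases)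
qed (auto simp: p1_def elim!: PB_cases)

lemma p2_hom:
  assumes "v_group Z" "g \<in> vhom Z X"
  shows "p2 Z g \<in> vhom (PB Z g) Z"
proof (rule vhomI)
  interpret Z: v_group Z by fact
  fix w w' assume "w \<in> carrier (PB Z g)" "w' \<in> carrier (PB Z g)"
  then show "p2 Z g (w \<otimes>\<^bsub>PB Z g\<^esub> w') = p2 Z g w \<otimes>\<^bsub>Z\<^esub> p2 Z g w'"
    "rel (PB Z g) w w' \<le> rel Z (p2 Z g w) (p2 Z g w')"
    using vhom_mult[OF assms(2)] vhom_mult[OF f_hom] by (auto elim!: PB_cases)
qed (auto simp: p2_def elim!: PB_cases)

lemma pair_hom:
  assumes "u \<in> vhom W Y" "v \<in> vhom W Z" "\<And>x. x \<in> carrier W \<Longrightarrow> f (u x) = g (v x)"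
    and "v_group W"
  shows "(\<lambda>x\<in>carrier W. j (u x, v x)) \<in> vhom W (PB Z g)"
proof (rule vhomI)
  interpret W: v_group W by fact
  note [simp] = vhom_closed[OF assms(1)] vhom_closed[OF assms(2)] assms(3)
    vhom_mult[OF assms(1)] vhom_mult[OF assms(2)] vhom_rel[OF assms(1)] vhom_rel[OF assms(2)]
  fix x y assume "x \<in> carrier W" "y \<in> carrier W"
  then show "(\<lambda>x\<in>carrier W. j (u x, v x)) (x \<otimes>\<^bsub>W\<^esub> y) =
      (\<lambda>x\<in>carrier W. j (u x, v x)) x \<otimes>\<^bsub>PB Z g\<^esub> (\<lambda>x\<in>carrier W. j (u x, v x)) y"
    "rel W x y \<le> rel (PB Z g) ((\<lambda>x\<in>carrier W. j (u x, v x)) x) ((\<lambda>x\<in>carrier W. j (u x, v x)) y)"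
    by simp_all
qed (use assms in \<open>auto simp: vhom_closed\<close>)

lemma is_pullback_PB:
  assumes "v_group Z" "g \<in> vhom Z X"
  shows "is_pullback VGrp (PB Z g) (p1 Z g) (p2 Z g) Y f Z g X"
  unfolding is_pullback_def
proof (intro conjI ballI impI)
  fix W u v assume "W \<in> Ob VGrp" and "u \<in> Hom VGrp W Y" and "v \<in> Hom VGrp W Z"
    and "Cmp VGrp W Y X f u = Cmp VGrp W Z X g v"
  then have W: "v_group W" and u: "u \<in> vhom W Y" and v: "v \<in> vhom W Z"
    and uv: "compose (carrier W) f u = compose (carrier W) g v" by simp_all
  have uv: "f (u x) = g (v x)" if "x \<in> carrier W" for x
    using fun_cong[OF uv, of x] that by (simp add: compose_eq)
  note [simp] = vhom_closed[OF u] vhom_closed[OF v] vhom_extensional[OF u] vhom_extensional[OF v] uv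
  show "\<exists>!w. w \<in> Hom VGrp W (PB Z g) \<and> Cmp VGrp W (PB Z g) Y (p1 Z g) w = u \<and>
      Cmp VGrp W (PB Z g) Z (p2 Z g) w = v"
  proof (rule ex1I[of _ "\<lambda>x\<in>carrier W. j (u x, v x)"])
    show "(\<lambda>x\<in>carrier W. j (u x, v x)) \<in> Hom VGrp W (PB Z g) \<and>
        Cmp VGrp W (PB Z g) Y (p1 Z g) (\<lambda>x\<in>carrier W. j (u x, v x)) = u \<and>
        Cmp VGrp W (PB Z g) Z (p2 Z g) (\<lambda>x\<in>carrier W. j (u x, v x)) = v"
      using pair_hom[OF u v uv W] by (auto intro!: compose_eqI)
  next
    fix w assume w: "w \<in> Hom VGrp W (PB Z g) \<and> Cmp VGrp W (PB Z g) Y (p1 Z g) w = u \<and>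
      Cmp VGrp W (PB Z g) Z (p2 Z g) w = v"
    then have wh: "w \<in> vhom W (PB Z g)" and wu: "compose (carrier W) (p1 Z g) w = u"
      and wv: "compose (carrier W) (p2 Z g) w = v" by simp_all
    show "w = (\<lambda>x\<in>carrier W. j (u x, v x))"
    proof (rule extensionalityI[of _ "carrier W"])
      fix x assume x: "x \<in> carrier W"
      have "w x = j (p1 Z g (w x), p2 Z g (w x))"
        by (rule PB_p[OF vhom_closed[OF wh x]])
      also have "\<dots> = (\<lambda>x\<in>carrier W. j (u x, v x)) x"
        using x compose_eqD[OF wu x] compose_eqD[OF wv x] by simp
      finally show "w x = (\<lambda>x\<in>carrier W. j (u x, v x)) x" .
    qed (use vhom_extensional[OF wh] in auto)
  qed
next
  show "Cmp VGrp (PB Z g) Y X f (p1 Z g) = Cmp VGrp (PB Z g) Z X g (p2 Z g)"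
    by (auto intro: compose_cong PB_commutes)
qed (use assms in \<open>auto intro: X v_group_Y f_hom v_group_PB p1_hom p2_hom\<close>)

definition Pbm :: "('u, 'v) vgroup \<Rightarrow> ('u \<Rightarrow> 'u) \<Rightarrow> ('u \<Rightarrow> 'u) \<Rightarrow> 'u \<Rightarrow> 'u" where
  "Pbm Z g h = (\<lambda>w\<in>carrier (PB Z g). j (p1 Z g w, h (p2 Z g w)))"

lemma Pbm_j [simp]: "\<lbrakk>y \<in> carrier Y; z \<in> carrier Z; f y = g z\<rbrakk> \<Longrightarrow> Pbm Z g h (j (y, z)) = j (y, h z)"
  by (simp add: Pbm_def)

lemma Pbm_ext [simp]: "Pbm Z g h \<in> extensional (carrier (PB Z g))"
  by (simp add: Pbm_def)

lemma Pbm_hom: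
  assumes "v_group Z" "g \<in> vhom Z X" "h \<in> vhom Z Z'" "compose (carrier Z) g' h = g"
  shows "Pbm Z g h \<in> vhom (PB Z g) (PB Z' g')"
proof -
  have "compose (carrier (PB Z g)) h (p2 Z g) \<in> vhom (PB Z g) Z'"
    using assms by (intro vhom_compose[where Y = Z] p2_hom v_group_PB)
  from pair_hom[OF p1_hom[OF assms(1,2)] this _ v_group_PB[OF assms(1,2)], of g']
  have "(\<lambda>x\<in>carrier (PB Z g). j (p1 Z g x, compose (carrier (PB Z g)) h (p2 Z g) x)) \<in>
      vhom (PB Z g) (PB Z' g')"
    using compose_eqD[OF assms(4)] by (simp add: compose_eq PB_commutes)
  also have "(\<lambda>x\<in>carrier (PB Z g). j (p1 Z g x, compose (carrier (PB Z g)) h (p2 Z g) x)) = Pbm Z g h"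
    unfolding Pbm_def by (rule restrict_ext) (simp add: compose_eq)
  finally show ?thesis .
qed

section \<open>The adjunction between composition with \<open>f\<close> and pullback along
  \<open>f\<close>\<close>

definition Pb :: "(('u, 'v) vgroup \<times> ('u \<Rightarrow> 'u), 'u \<Rightarrow> 'u, ('u, 'v) vgroup \<times> ('u \<Rightarrow> 'u), 'u \<Rightarrow> 'u) fctr" where
  "Pb = \<lparr>Fo = (\<lambda>(Z, g). (PB Z g, p1 Z g)), Fm = (\<lambda>(Z, g) _ h. Pbm Z g h)\<rparr>"

text \<open>Composition with \<open>f\<close>, often written as a dependent sum along
  \<open>f\<close>.\<close>

definition Sig :: "(('u, 'v) vgroup \<times> ('u \<Rightarrow> 'u), 'u \<Rightarrow> 'u, ('u, 'v) vgroup \<times> ('u \<Rightarrow> 'u), 'u \<Rightarrow> 'u) fctr" where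
  "Sig = \<lparr>Fo = (\<lambda>(A, \<pi>). (A, compose (carrier A) f \<pi>)), Fm = (\<lambda>_ _ h. h)\<rparr>"

lemma Pb_simps [simp]: "Fo Pb (Z, g) = (PB Z g, p1 Z g)" "Fm Pb (Z, g) A h = Pbm Z g h"
  and Sig_simps [simp]: "Fo Sig (Z, g) = (Z, compose (carrier Z) f g)" "Fm Sig B A h = h"
  by (simp_all add: Pb_def Sig_def)

sublocale SX: category "slice VGrp X"
  by (rule category_slice[OF category_VGrp]) (simp add: X)

sublocale SY: category "slice VGrp Y"
  by (rule category_slice[OF category_VGrp]) (simp add: v_group_Y)

lemma p1_Pbm:
  assumes "h \<in> vhom Z Z'" "compose (carrier Z) g' h = g"
  shows "compose (carrier (PB Z g)) (p1 Z' g') (Pbm Z g h) = p1 Z g"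
  by (rule compose_eqI)
    (use compose_eqD[OF assms(2)] in \<open>auto simp: p1_def vhom_closed[OF assms(1)] elim!: PB_cases\<close>)

lemma p2_Pbm:
  assumes "h \<in> vhom Z Z'" "compose (carrier Z) g' h = g"
  shows "compose (carrier (PB Z g)) (p2 Z' g') (Pbm Z g h) = compose (carrier (PB Z g)) h (p2 Z g)"
  by (rule compose_cong)
    (use compose_eqD[OF assms(2)] in \<open>auto simp: vhom_closed[OF assms(1)] elim!: PB_cases\<close>)

lemma Pbm_Ident: "Pbm Z g (\<lambda>z\<in>carrier Z. z) = (\<lambda>w\<in>carrier (PB Z g). w)"
  unfolding Pbm_def by (rule restrict_ext) (auto elim!: PB_cases)

lemma Pbm_compose:
  assumes "h \<in> vhom Z Z'" "compose (carrier Z) g' h = g"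
  shows "Pbm Z g (compose (carrier Z) k h) = compose (carrier (PB Z g)) (Pbm Z' g' k) (Pbm Z g h)"
  by (rule sym, rule compose_eqI)
    (use compose_eqD[OF assms(2)] in \<open>auto simp: vhom_closed[OF assms(1)] compose_eq elim!: PB_cases\<close>)

lemma Pb_functor: "cat_functor (slice VGrp X) (slice VGrp Y) Pb"
proof unfold_locales
  fix A :: "('u, 'v) vgroup \<times> ('u \<Rightarrow> 'u)" assume A: "A \<in> Ob (slice VGrp X)"
  then show "Fo Pb A \<in> Ob (slice VGrp Y)"
    by (cases A) (simp add: v_group_PB p1_hom)
  show "Fm Pb A A (Ident (slice VGrp X) A) = Ident (slice VGrp Y) (Fo Pb A)"
    by (cases A) (simp add: Pbm_Ident)
next
  fix A B h assume "A \<in> Ob (slice VGrp X)" "B \<in> Ob (slice VGrp X)" "h \<in> Hom (slice VGrp X) A B"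
  then show "Fm Pb A B h \<in> Hom (slice VGrp Y) (Fo Pb A) (Fo Pb B)"
    by (cases A; cases B) (simp add: Pbm_hom p1_Pbm)
next
  fix A B E h k assume "A \<in> Ob (slice VGrp X)" "B \<in> Ob (slice VGrp X)" "E \<in> Ob (slice VGrp X)"
    "h \<in> Hom (slice VGrp X) A B" "k \<in> Hom (slice VGrp X) B E"
  then show "Fm Pb A E (Cmp (slice VGrp X) A B E k h) =
      Cmp (slice VGrp Y) (Fo Pb A) (Fo Pb B) (Fo Pb E) (Fm Pb B E k) (Fm Pb A B h)"
    by (cases A; cases B; cases E) (auto intro: Pbm_compose)
qed

lemma Sig_functor: "cat_functor (slice VGrp Y) (slice VGrp X) Sig"
proof unfold_locales
  fix A :: "('u, 'v) vgroup \<times> ('u \<Rightarrow> 'u)" assume A: "A \<in> Ob (slice VGrp Y)"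
  then show "Fo Sig A \<in> Ob (slice VGrp X)"
    by (cases A) (auto intro: vhom_compose f_hom)
  show "Fm Sig A A (Ident (slice VGrp Y) A) = Ident (slice VGrp X) (Fo Sig A)"
    by (cases A) simp
next
  fix A B h assume "A \<in> Ob (slice VGrp Y)" "B \<in> Ob (slice VGrp Y)" "h \<in> Hom (slice VGrp Y) A B"
  then show "Fm Sig A B h \<in> Hom (slice VGrp X) (Fo Sig A) (Fo Sig B)"
    by (cases A; cases B) (auto intro!: compose_cong simp: compose_eq vhom_closed)
next
  fix A B E h k
  show "Fm Sig A E (Cmp (slice VGrp Y) A B E k h) =
      Cmp (slice VGrp X) (Fo Sig A) (Fo Sig B) (Fo Sig E) (Fm Sig B E k) (Fm Sig A B h)"
    by (cases A; cases B; cases E) simp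
qed

definition counit :: "('u, 'v) vgroup \<times> ('u \<Rightarrow> 'u) \<Rightarrow> 'u \<Rightarrow> 'u" where
  "counit = (\<lambda>(Z, g). p2 Z g)"

definition unit :: "('u, 'v) vgroup \<times> ('u \<Rightarrow> 'u) \<Rightarrow> 'u \<Rightarrow> 'u" where
  "unit = (\<lambda>(A, \<pi>). \<lambda>t\<in>carrier A. j (\<pi> t, t))"

lemma counit_simp [simp]: "counit (Z, g) = p2 Z g"
  and unit_simp [simp]: "unit (A, \<pi>) = (\<lambda>t\<in>carrier A. j (\<pi> t, t))"
  by (simp_all add: counit_def unit_def)

lemma pullback_functor_Pb: "pullback_functor VGrp Y X f Pb counit"
  unfolding pullback_functor_def
  using Pb_functor is_pullback_PB by (auto simp: p2_Pbm)

lemma adjunction_Sig_Pb: "adjunction (slice VGrp Y) (slice VGrp X) Sig Pb unit counit"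
  unfolding adjunction_def
proof (intro conjI ballI Sig_functor Pb_functor)
  have hom: "(\<lambda>t\<in>carrier A. j (\<pi> t, t)) \<in> vhom A (PB A (compose (carrier A) f \<pi>))"
    if "v_group A" "\<pi> \<in> vhom A Y" for A \<pi>
  proof -
    interpret A: v_group A by fact
    have "(\<lambda>t\<in>carrier A. t) \<in> vhom A A" by (rule vhomI) auto
    from pair_hom[OF that(2) this _ that(1), of "compose (carrier A) f \<pi>"]
    have "(\<lambda>t\<in>carrier A. j (\<pi> t, (\<lambda>t\<in>carrier A. t) t)) \<in> vhom A (PB A (compose (carrier A) f \<pi>))"
      by (simp add: compose_eq)
    also have "(\<lambda>t\<in>carrier A. j (\<pi> t, (\<lambda>t\<in>carrier A. t) t)) = (\<lambda>t\<in>carrier A. j (\<pi> t, t))"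
      by (rule restrict_ext) simp
    finally show ?thesis .
  qed
  show "nat_trans (slice VGrp Y) (slice VGrp Y) fid (fcomp Pb Sig) unit"
    unfolding nat_trans_def
  proof (intro conjI ballI)
    fix P :: "('u, 'v) vgroup \<times> ('u \<Rightarrow> 'u)" assume "P \<in> Ob (slice VGrp Y)"
    then show "unit P \<in> Hom (slice VGrp Y) (Fo fid P) (Fo (fcomp Pb Sig) P)"
      by (cases P) (auto simp: fid_def fcomp_def hom compose_eq vhom_closed dest: vhom_extensional
          intro!: compose_eqI)
  next
    fix P Q h assume "P \<in> Ob (slice VGrp Y)" "Q \<in> Ob (slice VGrp Y)" "h \<in> Hom (slice VGrp Y) P Q"
    then show "Cmp (slice VGrp Y) (Fo fid P) (Fo fid Q) (Fo (fcomp Pb Sig) Q) (unit Q) (Fm fid P Q h) =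
        Cmp (slice VGrp Y) (Fo fid P) (Fo (fcomp Pb Sig) P) (Fo (fcomp Pb Sig) Q)
          (Fm (fcomp Pb Sig) P Q h) (unit P)"
      by (cases P; cases Q) (auto simp: fid_def fcomp_def compose_eq vhom_closed intro!: compose_cong)
  qed
  show "nat_trans (slice VGrp X) (slice VGrp X) (fcomp Sig Pb) fid counit"
    unfolding nat_trans_def
  proof (intro conjI ballI)
    fix P :: "('u, 'v) vgroup \<times> ('u \<Rightarrow> 'u)" assume "P \<in> Ob (slice VGrp X)"
    then show "counit P \<in> Hom (slice VGrp X) (Fo (fcomp Sig Pb) P) (Fo fid P)"
      by (cases P) (auto simp: fid_def fcomp_def p2_hom PB_commutes intro!: compose_cong)
  next
    fix P Q h assume "P \<in> Ob (slice VGrp X)" "Q \<in> Ob (slice VGrp X)" "h \<in> Hom (slice VGrp X) P Q"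
    then show "Cmp (slice VGrp X) (Fo (fcomp Sig Pb) P) (Fo (fcomp Sig Pb) Q) (Fo fid Q) (counit Q)
          (Fm (fcomp Sig Pb) P Q h) =
        Cmp (slice VGrp X) (Fo (fcomp Sig Pb) P) (Fo fid P) (Fo fid Q) (Fm fid P Q h) (counit P)"
      by (cases P; cases Q) (auto simp: fid_def fcomp_def p2_Pbm)
  qed
  fix P :: "('u, 'v) vgroup \<times> ('u \<Rightarrow> 'u)"
  show "Cmp (slice VGrp X) (Fo Sig P) (Fo Sig (Fo Pb (Fo Sig P))) (Fo Sig P) (counit (Fo Sig P))
      (Fm Sig P (Fo Pb (Fo Sig P)) (unit P)) = Ident (slice VGrp X) (Fo Sig P)"
    if "P \<in> Ob (slice VGrp Y)"
    using that by (cases P) (auto simp: compose_eq vhom_closed intro!: compose_eqI)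
  show "Cmp (slice VGrp Y) (Fo Pb P) (Fo Pb (Fo Sig (Fo Pb P))) (Fo Pb P)
      (Fm Pb (Fo Sig (Fo Pb P)) P (counit P)) (unit (Fo Pb P)) = Ident (slice VGrp Y) (Fo Pb P)"
    if "P \<in> Ob (slice VGrp X)"
    using that by (cases P) (auto simp: compose_eq intro!: compose_eqI simp flip: PB_p)
qed

end

section \<open>Descent of actions\<close>

text \<open>\<open>a y t\<close> is the point over \<open>y\<close> in the orbit of
  \<open>t\<close>; the acting pair starts at \<open>\<pi> t\<close>, so only its target is an
  argument. An algebra of the monad gives \<open>a y t = \<alpha> (j (y, t))\<close>, an internal
  action gives \<open>a y t = \<xi> ((\<pi> t, y), t)\<close>. The value
  \<open>rel Y (\<pi> t) (\<pi> t')\<close> does not appear in \<open>a_rel\<close>, since it lies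
  above \<open>rel A t t'\<close> and is absorbed by the meet.\<close>

locale eq_action = int_cover X Y e f j
  for X Y :: "('u, 'v::comm_quantale) vgroup" and e f j +
  fixes A :: "('u, 'v) vgroup" and \<pi> :: "'u \<Rightarrow> 'u" and a :: "'u \<Rightarrow> 'u \<Rightarrow> 'u"
  assumes A: "v_group A" and \<pi>: "\<pi> \<in> vhom A Y"
    and a_closed [simp]: "\<lbrakk>y \<in> carrier Y; t \<in> carrier A; f y = f (\<pi> t)\<rbrakk> \<Longrightarrow> a y t \<in> carrier A"
    and \<pi>_a [simp]: "\<lbrakk>y \<in> carrier Y; t \<in> carrier A; f y = f (\<pi> t)\<rbrakk> \<Longrightarrow> \<pi> (a y t) = y"
    and a_a [simp]: "\<lbrakk>y \<in> carrier Y; y' \<in> carrier Y; t \<in> carrier A; f y = f (\<pi> t); f y' = f (\<pi> t)\<rbrakk>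
      \<Longrightarrow> a y' (a y t) = a y' t"
    and a_id [simp]: "t \<in> carrier A \<Longrightarrow> a (\<pi> t) t = t"
    and a_mult: "\<lbrakk>y \<in> carrier Y; t \<in> carrier A; f y = f (\<pi> t); y' \<in> carrier Y; t' \<in> carrier A; f y' = f (\<pi> t')\<rbrakk>
      \<Longrightarrow> a (y \<otimes>\<^bsub>Y\<^esub> y') (t \<otimes>\<^bsub>A\<^esub> t') = a y t \<otimes>\<^bsub>A\<^esub> a y' t'"
    and a_rel: "\<lbrakk>y \<in> carrier Y; t \<in> carrier A; f y = f (\<pi> t); y' \<in> carrier Y; t' \<in> carrier A; f y' = f (\<pi> t')\<rbrakk>
      \<Longrightarrow> inf (rel Y y y') (rel A t t') \<le> rel A (a y t) (a y' t')"
begin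

sublocale A: v_group A by (rule A)

lemma \<pi>_in [simp]: "t \<in> carrier A \<Longrightarrow> \<pi> t \<in> carrier Y"
  by (rule vhom_closed[OF \<pi>])

definition b :: "'u \<Rightarrow> 'u" where
  "b t = f (\<pi> t)"

lemma f_\<pi> [simp]: "f (\<pi> t) = b t"
  by (simp add: b_def)

lemma b_in [simp]: "t \<in> carrier A \<Longrightarrow> b t \<in> carrier X"
  unfolding b_def by (simp del: f_\<pi>)

lemma b_mult [simp]: "\<lbrakk>t \<in> carrier A; t' \<in> carrier A\<rbrakk> \<Longrightarrow> b (t \<otimes>\<^bsub>A\<^esub> t') = b t \<otimes>\<^bsub>X\<^esub> b t'"
  unfolding b_def by (simp add: vhom_mult[OF \<pi>] vhom_mult[OF f_hom] del: f_\<pi>)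

lemma b_a [simp]: "\<lbrakk>y \<in> carrier Y; t \<in> carrier A; f y = b t\<rbrakk> \<Longrightarrow> b (a y t) = b t"
  unfolding b_def[of "a y t"] by (subst \<pi>_a) auto

text \<open>An orbit has one point over each element of Y with the same image in X as the orbit;
  this picks the one on level \<open>n\<close>.\<close>

definition lvl :: "int \<Rightarrow> 'u \<Rightarrow> 'u" where
  "lvl n t = a (e (n, b t)) t"

lemma lvl_in [simp]: "t \<in> carrier A \<Longrightarrow> lvl n t \<in> carrier A"
  and \<pi>_lvl [simp]: "t \<in> carrier A \<Longrightarrow> \<pi> (lvl n t) = e (n, b t)"
  by (simp_all add: lvl_def)

lemma b_lvl [simp]: "t \<in> carrier A \<Longrightarrow> b (lvl n t) = b t"
  by (simp add: lvl_def)

lemma lvl_lvl [simp]: "t \<in> carrier A \<Longrightarrow> lvl m (lvl n t) = lvl m t"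
  by (simp add: lvl_def)

lemma lvl_mult:
  "\<lbrakk>t \<in> carrier A; t' \<in> carrier A\<rbrakk> \<Longrightarrow> lvl (m + n) (t \<otimes>\<^bsub>A\<^esub> t') = lvl m t \<otimes>\<^bsub>A\<^esub> lvl n t'"
  by (simp add: lvl_def flip: a_mult)

text \<open>The heart of the descent. For \<open>m < n\<close> the value in Y between the two
  targets is \<open>rel X (b t) (b t')\<close>, which lies above \<open>rel A t t'\<close> because
  \<open>f\<close> and \<pi> are V-homomorphisms; so it disappears from the meet in
  \<open>a_rel\<close>. For \<open>m = n\<close> it would be bot as soon as \<open>b t\<close> and
  \<open>b t'\<close> differ.\<close>

lemma rel_lvl:
  assumes "t \<in> carrier A" "t' \<in> carrier A" "m < n"
  shows "rel A t t' \<le> rel A (lvl m t) (lvl n t')"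
proof -
  have "rel A t t' \<le> rel Y (\<pi> t) (\<pi> t')" using assms by (intro vhom_rel[OF \<pi>])
  also have "\<dots> \<le> rel X (b t) (b t')" using assms rel_Y_le[of "\<pi> t" "\<pi> t'"] by simp
  also have "\<dots> = rel Y (e (m, b t)) (e (n, b t'))" using assms by (simp add: e_rel)
  finally have "rel A t t' = inf (rel Y (e (m, b t)) (e (n, b t'))) (rel A t t')"
    by (simp add: inf_absorb2)
  also have "\<dots> \<le> rel A (lvl m t) (lvl n t')"
    unfolding lvl_def by (rule a_rel) (use assms in auto)
  finally show ?thesis .
qed

section \<open>The quotient of \<open>A\<close> by the action\<close>

definition Z0 :: "'u set" where
  "Z0 = {t \<in> carrier A. \<pi> t = e (0, b t)}"

lemma Z0D: "t \<in> Z0 \<Longrightarrow> t \<in> carrier A" "t \<in> Z0 \<Longrightarrow> \<pi> t = e (0, b t)"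
  and lvl_0: "t \<in> Z0 \<Longrightarrow> lvl 0 t = t"
  by (auto simp: Z0_def lvl_def) (metis a_id)

lemma lvl_0_in: "t \<in> carrier A \<Longrightarrow> lvl 0 t \<in> Z0"
  by (simp add: Z0_def)

lemma subgroup_Z0: "subgroup Z0 A"
proof -
  interpret \<pi>: group_hom A Y \<pi> using \<pi> by unfold_locales (rule vhom_hom)
  \<comment> \<open>Since \<open>b t\<close> is determined by \<open>\<pi> t\<close>, membership
    says that \<open>t\<close> lies in the preimage of the subgroup of level-0 elements of
    Y.\<close>
  have "t \<in> Z0 \<longleftrightarrow> t \<in> carrier A \<and> (\<exists>x\<in>carrier X. \<pi> t = e (0, x))" for t
    unfolding Z0_def by auto (metis f_e f_\<pi>)
  note mem = this
  show ?thesis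
  proof
    fix t t' assume "t \<in> Z0" "t' \<in> Z0"
    then show "t \<otimes>\<^bsub>A\<^esub> t' \<in> Z0" by (auto simp: mem)
  next
    fix t assume t: "t \<in> Z0"
    then obtain x where x: "x \<in> carrier X" "\<pi> t = e (0, x)" "t \<in> carrier A" by (auto simp: mem)
    have "inv\<^bsub>Y\<^esub> e (0, x) = e (0, inv\<^bsub>X\<^esub> x)"
      by (rule Y.inv_equality) (use x in \<open>simp_all add: one_Y\<close>)
    then show "inv\<^bsub>A\<^esub> t \<in> Z0" using x by (auto simp: mem)
  qed (auto simp: mem one_Y)
qed

text \<open>The quotient of \<open>A\<close> by the action: every orbit meets the level \<open>0\<close> in exactly one point. The
  supremum defining the quotient structure is attained between any two levels \<open>m < n\<close>.\<close>

definition Z :: "('u, 'v) vgroup" where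
  "Z = vgroup_of (A\<lparr>carrier := Z0\<rparr>) (\<lambda>t t'. rel A t (lvl 1 t'))"

definition g :: "'u \<Rightarrow> 'u" where
  "g = restrict b Z0"

lemma Z_simps [simp]: "carrier Z = Z0" "t \<otimes>\<^bsub>Z\<^esub> t' = t \<otimes>\<^bsub>A\<^esub> t'" "\<one>\<^bsub>Z\<^esub> = \<one>\<^bsub>A\<^esub>"
  "rel Z t t' = rel A t (lvl 1 t')"
  by (simp_all add: Z_def vgroup_of_def)

lemma rel_Z_ge: "\<lbrakk>t \<in> carrier A; t' \<in> carrier A\<rbrakk> \<Longrightarrow> rel A t t' \<le> rel Z (lvl 0 t) (lvl 0 t')"
  using rel_lvl[of t t' 0 1] by simp

text \<open>Transitivity and compatibility with the product both arrive at level 2: the first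
  composes a step from level 0 to 1 with one from level 1 to 2, the second adds levels, 1 + 1.
  \<open>rel_lvl\<close> for the levels 0 and 1 brings the value back to the form defining
  \<open>rel Z\<close>.\<close>

lemma v_group_Z: "v_group Z"
proof -
  interpret Z0: subgroup Z0 A by (rule subgroup_Z0)
  have "group Z"
  proof (rule groupI)
    fix t assume "t \<in> carrier Z"
    then show "\<exists>t'\<in>carrier Z. t' \<otimes>\<^bsub>Z\<^esub> t = \<one>\<^bsub>Z\<^esub>"
      by (intro bexI[of _ "inv\<^bsub>A\<^esub> t"]) auto
  qed (auto simp: A.m_assoc)
  then show ?thesis
  proof (rule v_groupI)
    fix t assume "t \<in> carrier Z"
    then have t: "t \<in> carrier A" "lvl 0 t = t" by (auto simp: Z0D lvl_0)
    show "1 \<le> rel Z t t"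
      using A.unit_le[OF t(1)] rel_lvl[OF t(1) t(1), of 0 1] t by simp
  next
    fix t t' t'' assume "t \<in> carrier Z" "t' \<in> carrier Z" "t'' \<in> carrier Z"
    then have t: "t \<in> carrier A" "t' \<in> carrier A" "t'' \<in> carrier A" "lvl 0 t = t"
      by (auto simp: Z0D lvl_0)
    have "rel A t' (lvl 1 t'') \<le> rel A (lvl 1 t') (lvl 2 (lvl 1 t''))"
      by (rule rel_lvl) (use t in auto)
    then have "rel Z t t' * rel Z t' t'' \<le> rel A t (lvl 1 t') * rel A (lvl 1 t') (lvl 2 t'')"
      using t by (auto intro: quantale_mult_mono)
    also have "\<dots> \<le> rel A t (lvl 2 t'')" by (rule A.comp_le) (use t in auto)
    also have "\<dots> \<le> rel A (lvl 0 t) (lvl 1 (lvl 2 t''))" by (rule rel_lvl) (use t in auto)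
    also have "\<dots> = rel Z t t''" using t by simp
    finally show "rel Z t t' * rel Z t' t'' \<le> rel Z t t''" .
  next
    fix t u t' u' assume "t \<in> carrier Z" "t' \<in> carrier Z" "u \<in> carrier Z" "u' \<in> carrier Z"
    then have t: "t \<in> carrier A" "t' \<in> carrier A" "u \<in> carrier A" "u' \<in> carrier A"
      "lvl 0 t = t" "lvl 0 u = u" by (auto simp: Z0D lvl_0)
    have "rel Z t t' * rel Z u u' \<le> rel A (t \<otimes>\<^bsub>A\<^esub> u) (lvl 1 t' \<otimes>\<^bsub>A\<^esub> lvl 1 u')"
      using t by (simp add: A.mult_le)
    also have "\<dots> = rel A (t \<otimes>\<^bsub>A\<^esub> u) (lvl 2 (t' \<otimes>\<^bsub>A\<^esub> u'))"
      using lvl_mult[OF t(2,4), of 1 1] by simp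
    also have "\<dots> \<le> rel A (lvl 0 (t \<otimes>\<^bsub>A\<^esub> u)) (lvl 1 (lvl 2 (t' \<otimes>\<^bsub>A\<^esub> u')))"
      by (rule rel_lvl) (use t in auto)
    also have "\<dots> = rel Z (t \<otimes>\<^bsub>Z\<^esub> u) (t' \<otimes>\<^bsub>Z\<^esub> u')"
      using t lvl_mult[OF t(1,3), of 0 0] by simp
    finally show "rel Z t t' * rel Z u u' \<le> rel Z (t \<otimes>\<^bsub>Z\<^esub> u) (t' \<otimes>\<^bsub>Z\<^esub> u')" .
  qed
qed

lemma g_hom: "g \<in> vhom Z X"
proof (rule vhomI)
  interpret Z0: subgroup Z0 A by (rule subgroup_Z0)
  fix t t' assume "t \<in> carrier Z" "t' \<in> carrier Z"
  then have t: "t \<in> Z0" "t' \<in> Z0" by auto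
  then show "g (t \<otimes>\<^bsub>Z\<^esub> t') = g t \<otimes>\<^bsub>X\<^esub> g t'"
    by (simp add: g_def)
  have "rel A t (lvl 1 t') \<le> rel Y (\<pi> t) (\<pi> (lvl 1 t'))"
    by (rule vhom_rel[OF \<pi>]) (use t in auto)
  also have "\<dots> = rel X (b t) (b t')" using t by (simp add: Z0D e_rel)
  finally show "rel Z t t' \<le> rel X (g t) (g t')" using t by (simp add: g_def)
qed (auto simp: g_def Z0D)

lemma g_simp [simp]: "t \<in> Z0 \<Longrightarrow> g t = b t"
  by (simp add: g_def)

text \<open>With its inverse \<psi> this identifies \<open>A\<close> with the pullback of
  \<open>Z\<close> along \<open>f\<close>: an element of \<open>A\<close> is determined by its image
  in Y and the level-0 point of its orbit.\<close>

definition \<phi> :: "'u \<Rightarrow> 'u" where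
  "\<phi> = (\<lambda>w\<in>carrier (PB Z g). a (p1 Z g w) (p2 Z g w))"

definition \<psi> :: "'u \<Rightarrow> 'u" where
  "\<psi> = (\<lambda>t\<in>carrier A. j (\<pi> t, lvl 0 t))"

lemma \<phi>_j [simp]: "\<lbrakk>y \<in> carrier Y; t \<in> Z0; f y = b t\<rbrakk> \<Longrightarrow> \<phi> (j (y, t)) = a y t"
  by (simp add: \<phi>_def)

lemma \<phi>_hom: "\<phi> \<in> vhom (PB Z g) A"
proof (rule vhomI)
  interpret Z0: subgroup Z0 A by (rule subgroup_Z0)
  fix w w' assume w: "w \<in> carrier (PB Z g)" "w' \<in> carrier (PB Z g)"
  then obtain y t y' t' where *: "w = j (y, t)" "y \<in> carrier Y" "t \<in> Z0" "f y = b t"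
    "w' = j (y', t')" "y' \<in> carrier Y" "t' \<in> Z0" "f y' = b t'"
    by (elim PB_cases) auto
  have fb: "f y = f (\<pi> t)" "f y' = f (\<pi> t')" using * by auto
  show "\<phi> (w \<otimes>\<^bsub>PB Z g\<^esub> w') = \<phi> w \<otimes>\<^bsub>A\<^esub> \<phi> w'"
    using * fb by (simp add: vhom_mult[OF f_hom] a_mult)
  have "rel (PB Z g) w w' = inf (rel Y y y') (rel A t (lvl 1 t'))"
    using * by simp
  also have "\<dots> \<le> rel A (a y t) (a y' (lvl 1 t'))"
    by (rule a_rel) (use * fb in \<open>auto simp: Z0D\<close>)
  \<comment> \<open>The action forgets where in its orbit an element stood, so the shift built into
    \<open>rel Z\<close> vanishes.\<close>
  also have "a y' (lvl 1 t') = a y' t'"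
    unfolding lvl_def by (rule a_a) (use * fb in \<open>auto\<close>)
  finally show "rel (PB Z g) w w' \<le> rel A (\<phi> w) (\<phi> w')"
    using * by simp
qed (auto simp: \<phi>_def Z0D(1) elim!: PB_cases)

lemma \<psi>_hom: "\<psi> \<in> vhom A (PB Z g)"
proof -
  have "(\<lambda>t\<in>carrier A. lvl 0 t) \<in> vhom A Z"
  proof (rule vhomI)
    fix t t' assume "t \<in> carrier A" "t' \<in> carrier A"
    then show "(\<lambda>t\<in>carrier A. lvl 0 t) (t \<otimes>\<^bsub>A\<^esub> t') =
        (\<lambda>t\<in>carrier A. lvl 0 t) t \<otimes>\<^bsub>Z\<^esub> (\<lambda>t\<in>carrier A. lvl 0 t) t'"
      "rel A t t' \<le> rel Z ((\<lambda>t\<in>carrier A. lvl 0 t) t) ((\<lambda>t\<in>carrier A. lvl 0 t) t')"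
      using lvl_mult[of t t' 0 0] rel_Z_ge[of t t'] by simp_all
  qed (auto simp: lvl_0_in)
  from pair_hom[OF \<pi> this _ A, of g]
  have "(\<lambda>t\<in>carrier A. j (\<pi> t, (\<lambda>t\<in>carrier A. lvl 0 t) t)) \<in> vhom A (PB Z g)"
    by (simp add: lvl_0_in)
  also have "(\<lambda>t\<in>carrier A. j (\<pi> t, (\<lambda>t\<in>carrier A. lvl 0 t) t)) = \<psi>"
    unfolding \<psi>_def by (rule restrict_ext) simp
  finally show ?thesis .
qed

lemma \<phi>_\<psi> [simp]: "t \<in> carrier A \<Longrightarrow> \<phi> (\<psi> t) = t"
  by (simp add: \<psi>_def lvl_0_in) (simp add: lvl_def)

lemma \<psi>_\<phi> [simp]:
  assumes "w \<in> carrier (PB Z g)"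
  shows "\<psi> (\<phi> w) = w"
proof -
  obtain y t where *: "w = j (y, t)" "y \<in> carrier Y" "t \<in> Z0" "f y = b t"
    using assms by (elim PB_cases) auto
  then have "lvl 0 (a y t) = lvl 0 t"
    by (simp add: lvl_def Z0D(1))
  then show ?thesis using * by (simp add: \<psi>_def Z0D(1) lvl_0)
qed

lemma \<pi>_\<phi>: "w \<in> carrier (PB Z g) \<Longrightarrow> \<pi> (\<phi> w) = p1 Z g w"
  by (elim PB_cases) (simp add: Z0D(1))

lemma \<phi>_equivariant:
  "\<lbrakk>w \<in> carrier (PB Z g); y \<in> carrier Y; f y = f (p1 Z g w)\<rbrakk> \<Longrightarrow> \<phi> (j (y, p2 Z g w)) = a y (\<phi> w)"
  by (elim PB_cases) (simp add: Z0D(1))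

lemma p1_\<psi>: "t \<in> carrier A \<Longrightarrow> p1 Z g (\<psi> t) = \<pi> t"
  by (simp add: \<psi>_def lvl_0_in)

lemma \<psi>_equivariant:
  assumes "t \<in> carrier A" "y \<in> carrier Y" "f y = b t"
  shows "\<psi> (a y t) = j (y, p2 Z g (\<psi> t))"
proof -
  have w: "\<psi> t \<in> carrier (PB Z g)" by (rule vhom_closed[OF \<psi>_hom assms(1)])
  \<comment> \<open>Equivariance of the inverse is obtained from that of \<phi> at
    \<open>\<psi> t\<close>, by applying \<psi> to both sides.\<close>
  have "a y t = \<phi> (j (y, p2 Z g (\<psi> t)))"
    using \<phi>_equivariant[OF w assms(2)] assms by (simp add: p1_\<psi>)
  moreover have "j (y, p2 Z g (\<psi> t)) \<in> carrier (PB Z g)"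
    using assms by (simp add: \<psi>_def lvl_0_in)
  ultimately show ?thesis by (metis \<psi>_\<phi>)
qed

end

text \<open>Hypothesis \<open>p2\<close> is the form in which equivariance enters, both for algebras
  and for internal actions. It allows \<open>h z\<close> to be read off at any point of Y over
  \<open>g z\<close>. This freedom is what makes \<open>h\<close> preserve the structure: the first
  argument is read at level 0 and the second at level 1.\<close>

lemma (in int_cover) ex1_Pbm:
  assumes Z: "v_group Z" "g \<in> vhom Z X" and Z': "v_group Z'" "g' \<in> vhom Z' X"
    and k: "k \<in> vhom (PB Z g) (PB Z' g')"
    and p1: "\<And>w. w \<in> carrier (PB Z g) \<Longrightarrow> p1 Z' g' (k w) = p1 Z g w"
    and p2: "\<And>y y' z. \<lbrakk>y \<in> carrier Y; y' \<in> carrier Y; z \<in> carrier Z; f y = g z; f y' = g z\<rbrakk>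
      \<Longrightarrow> p2 Z' g' (k (j (y, z))) = p2 Z' g' (k (j (y', z)))"
  shows "\<exists>!h. (h \<in> vhom Z Z' \<and> compose (carrier Z) g' h = g) \<and> Pbm Z g h = k"
proof -
  interpret Z: v_group Z by (rule Z)
  note [simp] = vhom_closed[OF Z(2)] vhom_closed[OF k] vhom_closed[OF p2_hom[OF Z']]
  define h where "h = (\<lambda>z\<in>carrier Z. p2 Z' g' (k (j (e (0, g z), z))))"
  have h: "h z = p2 Z' g' (k (j (y, z)))" if "y \<in> carrier Y" "z \<in> carrier Z" "f y = g z" for y z
    using that by (simp add: h_def) (rule p2; simp)
  have "h \<in> vhom Z Z'"
  proof (rule vhomI)
    fix z z' assume z: "z \<in> carrier Z" "z' \<in> carrier Z"
    show "h (z \<otimes>\<^bsub>Z\<^esub> z') = h z \<otimes>\<^bsub>Z'\<^esub> h z'"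
    proof -
      have "j (e (0, g (z \<otimes>\<^bsub>Z\<^esub> z')), z \<otimes>\<^bsub>Z\<^esub> z') =
          j (e (0, g z), z) \<otimes>\<^bsub>PB Z g\<^esub> j (e (0, g z'), z')"
        using z by (simp add: vhom_mult[OF Z(2)])
      then have "k (j (e (0, g (z \<otimes>\<^bsub>Z\<^esub> z')), z \<otimes>\<^bsub>Z\<^esub> z')) =
          k (j (e (0, g z), z)) \<otimes>\<^bsub>PB Z' g'\<^esub> k (j (e (0, g z'), z'))"
        using z by (simp only:) (rule vhom_mult[OF k]; simp)
      then show ?thesis
        using z by (simp add: h_def vhom_mult[OF p2_hom[OF Z']])
    qed
    \<comment> \<open>From level 0 to level 1 the value in Y is \<open>rel X (g z) (g z')\<close>,
      which lies above \<open>rel Z z z'\<close>; so the meet on the pullback is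
      \<open>rel Z z z'\<close> itself.\<close>
    have "rel Z z z' = rel (PB Z g) (j (e (0, g z), z)) (j (e (1, g z'), z'))"
      using z vhom_rel[OF Z(2) z] by (simp add: e_rel inf_absorb2)
    also have "\<dots> \<le> rel (PB Z' g') (k (j (e (0, g z), z))) (k (j (e (1, g z'), z')))"
      by (rule vhom_rel[OF k]) (use z in auto)
    also have "\<dots> \<le> rel Z' (h z) (h z')"
      using z vhom_rel[OF p2_hom[OF Z']] h[of "e (0, g z)" z] h[of "e (1, g z')" z'] by simp
    finally show "rel Z z z' \<le> rel Z' (h z) (h z')" .
  qed (auto simp: h_def)
  moreover have "compose (carrier Z) g' h = g"
  proof (rule compose_eqI)
    fix z assume z: "z \<in> carrier Z"
    then show "g' (h z) = g z"
      using PB_commutes[of "k (j (e (0, g z), z))" Z' g'] p1[of "j (e (0, g z), z)"] by (simp add: h_def)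
  qed (rule vhom_extensional[OF Z(2)])
  moreover have "Pbm Z g h = k"
  proof (rule extensionalityI[OF Pbm_ext vhom_extensional[OF k]])
    fix w assume w: "w \<in> carrier (PB Z g)"
    then obtain y z where yz: "w = j (y, z)" "y \<in> carrier Y" "z \<in> carrier Z" "f y = g z"
      by (rule PB_cases)
    then show "Pbm Z g h w = k w"
      using PB_p[OF vhom_closed[OF k w]] p1[OF w] h[OF yz(2-)] by simp
  qed
  moreover have "h' = h" if h': "h' \<in> vhom Z Z'" "compose (carrier Z) g' h' = g" "Pbm Z g h' = k" for h'
  proof (rule vhom_eqI[OF h'(1) \<open>h \<in> vhom Z Z'\<close>])
    fix z assume z: "z \<in> carrier Z"
    have "k (j (e (0, g z), z)) = j (e (0, g z), h' z)"
      using z h'(3) by (metis Pbm_j e_in_Y f_e vhom_closed[OF Z(2)])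
    then show "h' z = h z"
      using z compose_eqD[OF h'(2) z] vhom_closed[OF h'(1) z] by (simp add: h_def)
  qed
  ultimately show ?thesis by blast
qed

section \<open>Monadicity and the equivalence\<close>

context int_cover
begin

lemma monadic_Pb: "monadic (slice VGrp X) (slice VGrp Y) Pb"
proof -
  let ?M = "eilenberg_moore (slice VGrp Y) (fcomp Pb Sig) unit
    (\<lambda>A. Fm Pb (Fo Sig (Fo Pb (Fo Sig A))) (Fo Sig A) (counit (Fo Sig A)))"
  let ?K = "comparison Pb Sig counit"
  note M_simps = eilenberg_moore_def comparison_def fcomp_def
  have "is_equivalence (slice VGrp X) ?M ?K"
  proof (rule is_equivalence_if_fully_faithful_ess_surj)
    show "cat_functor (slice VGrp X) ?M ?K"
      by (rule cat_functor_comparison[OF adjunction_Sig_Pb])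
  next
    fix P Q :: "('u, 'v) vgroup \<times> ('u \<Rightarrow> 'u)" and k
    assume PQ: "P \<in> Ob (slice VGrp X)" "Q \<in> Ob (slice VGrp X)" "k \<in> Hom ?M (Fo ?K P) (Fo ?K Q)"
    obtain Z g where P: "P = (Z, g)" by (cases P)
    obtain Z' g' where Q: "Q = (Z', g')" by (cases Q)
    let ?s = "compose (carrier (PB Z g)) f (p1 Z g)" and ?s' = "compose (carrier (PB Z' g')) f (p1 Z' g')"
    have Z: "v_group Z" "g \<in> vhom Z X" "v_group Z'" "g' \<in> vhom Z' X"
      and k: "k \<in> vhom (PB Z g) (PB Z' g')"
      and k1: "compose (carrier (PB Z g)) (p1 Z' g') k = p1 Z g"
      and k2: "compose (carrier (PB (PB Z g) ?s)) k (Pbm (PB Z g) ?s (p2 Z g)) =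
        compose (carrier (PB (PB Z g) ?s)) (Pbm (PB Z' g') ?s' (p2 Z' g')) (Pbm (PB Z g) ?s k)"
      using PQ by (simp_all add: M_simps P Q)
    have "\<exists>!h. (h \<in> vhom Z Z' \<and> compose (carrier Z) g' h = g) \<and> Pbm Z g h = k"
    proof (rule ex1_Pbm[OF Z k])
      show p1: "p1 Z' g' (k w) = p1 Z g w" if "w \<in> carrier (PB Z g)" for w
        by (rule compose_eqD[OF k1 that])
      fix y y' z assume *: "y \<in> carrier Y" "y' \<in> carrier Y" "z \<in> carrier Z" "f y = g z" "f y' = g z"
      have w: "j (y', z) \<in> carrier (PB Z g)" using * by simp
      let ?w = "k (j (y', z))"
      have kw: "?w \<in> carrier (PB Z' g')" by (rule vhom_closed[OF k w])
      have p: "p1 Z' g' ?w = y'" using p1[OF w] * by simp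
      \<comment> \<open>The homomorphism law \<open>k2\<close> at the nested pair (y, (y', z)): one
        side is \<open>k\<close> at (y, z), the other keeps \<open>y\<close> and takes the second
        component of \<open>k\<close> at (y', z).\<close>
      have "k (j (y, z)) = j (y, p2 Z' g' ?w)"
        using fun_cong[OF k2, of "j (y, j (y', z))"] * kw p by (simp add: compose_eq)
      moreover have "f y = g' (p2 Z' g' ?w)" using PB_commutes[OF kw] p * by simp
      ultimately show "p2 Z' g' (k (j (y, z))) = p2 Z' g' ?w" using * kw by simp
    qed
    then show "\<exists>!h. h \<in> Hom (slice VGrp X) P Q \<and> Fm ?K P Q h = k"
      by (simp add: P Q comparison_def)
  next
    fix E assume E: "E \<in> Ob ?M"
    obtain A \<pi> \<alpha> where E_eq: "E = ((A, \<pi>), \<alpha>)" by (metis surj_pair)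
    let ?s = "compose (carrier A) f \<pi>"
    let ?s2 = "compose (carrier (PB A ?s)) f (p1 A ?s)"
    have A: "v_group A" and \<pi>: "\<pi> \<in> vhom A Y" and \<alpha>: "\<alpha> \<in> vhom (PB A ?s) A"
      and \<alpha>1: "compose (carrier (PB A ?s)) \<pi> \<alpha> = p1 A ?s"
      and \<alpha>2: "compose (carrier A) \<alpha> (\<lambda>t\<in>carrier A. j (\<pi> t, t)) = (\<lambda>t\<in>carrier A. t)"
      and \<alpha>3: "compose (carrier (PB (PB A ?s) ?s2)) \<alpha> (Pbm (PB A ?s) ?s2 \<alpha>) =
        compose (carrier (PB (PB A ?s) ?s2)) \<alpha> (Pbm (PB A ?s) ?s2 (p2 A ?s))"
      using E by (auto simp: M_simps E_eq)
    interpret A: v_group A by (rule A)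
    note [simp] = vhom_closed[OF \<pi>]
    have s [simp]: "?s t = f (\<pi> t)" if "t \<in> carrier A" for t
      using that by (simp add: compose_eq)
    have \<pi>\<alpha>: "\<pi> (\<alpha> (j (y, t))) = y" if "y \<in> carrier Y" "t \<in> carrier A" "f y = f (\<pi> t)" for y t
      using compose_eqD[OF \<alpha>1, of "j (y, t)"] that by simp
    \<comment> \<open>The multiplication law \<open>\<alpha>3\<close> at the nested pair (y', (y,
      t)) is \<open>a_a\<close>, the unit law \<open>\<alpha>2\<close> is \<open>a_id\<close>, and
      \<open>\<alpha>1\<close>, that \<alpha> is a morphism over Y, is
      \<open>\<pi>_a\<close>.\<close>
    interpret E: eq_action X Y e f j A \<pi> "\<lambda>y t. \<alpha> (j (y, t))"
    proof
      fix y t assume yt: "y \<in> carrier Y" "t \<in> carrier A" "f y = f (\<pi> t)"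
      then show \<alpha>_in: "\<alpha> (j (y, t)) \<in> carrier A" by (intro vhom_closed[OF \<alpha>]) simp
      show "\<pi> (\<alpha> (j (y, t))) = y" by (rule \<pi>\<alpha>[OF yt])
      show "\<alpha> (j (y', \<alpha> (j (y, t)))) = \<alpha> (j (y', t))" if "y' \<in> carrier Y" "f y' = f (\<pi> t)" for y'
        using fun_cong[OF \<alpha>3, of "j (y', j (y, t))"] yt that \<alpha>_in by (simp add: compose_eq)
      fix y' t' assume yt': "y' \<in> carrier Y" "t' \<in> carrier A" "f y' = f (\<pi> t')"
      have in_PB: "j (y, t) \<in> carrier (PB A ?s)" "j (y', t') \<in> carrier (PB A ?s)"
        using yt yt' by simp_all
      show "\<alpha> (j (y \<otimes>\<^bsub>Y\<^esub> y', t \<otimes>\<^bsub>A\<^esub> t')) = \<alpha> (j (y, t)) \<otimes>\<^bsub>A\<^esub> \<alpha> (j (y', t'))"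
        using vhom_mult[OF \<alpha> in_PB] yt yt' by simp
      show "inf (rel Y y y') (rel A t t') \<le> rel A (\<alpha> (j (y, t))) (\<alpha> (j (y', t')))"
        using vhom_rel[OF \<alpha> in_PB] yt yt' by simp
    next
      fix t assume "t \<in> carrier A"
      then show "\<alpha> (j (\<pi> t, t)) = t" using fun_cong[OF \<alpha>2, of t] by (simp add: compose_eq)
    qed (use A \<pi> in auto)
    let ?Z = E.Z and ?g = E.g
    let ?P = "PB ?Z ?g"
    let ?sP = "compose (carrier ?P) f (p1 ?Z ?g)"
    note [simp] = vhom_closed[OF E.\<phi>_hom] vhom_closed[OF E.\<psi>_hom]
    have "E.\<phi> \<in> Hom ?M (Fo ?K (?Z, ?g)) E"
    proof -
      have "compose (carrier ?P) \<pi> E.\<phi> = p1 ?Z ?g"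
        by (rule compose_eqI)
          (simp_all add: vhom_extensional[OF p1_hom[OF E.v_group_Z E.g_hom]] E.\<pi>_\<phi>)
      moreover have "compose (carrier (PB ?P ?sP)) E.\<phi> (Pbm ?P ?sP (p2 ?Z ?g)) =
          compose (carrier (PB ?P ?sP)) \<alpha> (Pbm ?P ?sP E.\<phi>)"
        by (rule compose_cong) (auto simp: compose_eq E.\<phi>_equivariant elim!: PB_cases[of _ ?P])
      ultimately show ?thesis
        by (simp add: M_simps E_eq E.\<phi>_hom)
    qed
    moreover have "E.\<psi> \<in> Hom ?M E (Fo ?K (?Z, ?g))"
    proof -
      have "compose (carrier A) (p1 ?Z ?g) E.\<psi> = \<pi>"
        by (rule compose_eqI) (simp_all add: vhom_extensional[OF \<pi>] E.p1_\<psi>)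
      moreover have "compose (carrier (PB A ?s)) E.\<psi> \<alpha> =
          compose (carrier (PB A ?s)) (Pbm ?P ?sP (p2 ?Z ?g)) (Pbm A ?s E.\<psi>)"
        by (rule compose_cong)
          (auto simp: compose_eq E.p1_\<psi> E.\<psi>_equivariant elim!: PB_cases[of _ A])
      ultimately show ?thesis
        by (simp add: M_simps E_eq E.\<psi>_hom)
    qed
    moreover have "compose (carrier ?P) E.\<psi> E.\<phi> = (\<lambda>w\<in>carrier ?P. w)"
      by (rule compose_eqI) auto
    moreover have "compose (carrier A) E.\<phi> E.\<psi> = (\<lambda>t\<in>carrier A. t)"
      by (rule compose_eqI) auto
    ultimately have "is_iso ?M (Fo ?K (?Z, ?g)) E E.\<phi>"
      by (auto simp: is_iso_def M_simps E_eq intro!: bexI[of _ E.\<psi>])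
    moreover have "(?Z, ?g) \<in> Ob (slice VGrp X)"
      using E.v_group_Z E.g_hom by simp
    ultimately show "\<exists>P\<in>Ob (slice VGrp X). \<exists>\<phi>. is_iso ?M (Fo ?K P) E \<phi>" by blast
  qed
  then show ?thesis
    unfolding monadic_def using adjunction_Sig_Pb by blast
qed

lemma effective_descent_f: "effective_descent VGrp Y X f"
  unfolding effective_descent_def
  using X v_group_Y f_hom pullback_functor_Pb monadic_Pb by auto

section \<open>Coverings and separatedness of the pullback along \<open>f\<close>\<close>

lemma separated_PB_if_covering:
  assumes "v_group Z" "covering Z X g"
  shows "separated (PB Z g)"
proof -
  have g: "g \<in> vhom Z X" using assms(2) by (simp add: covering_def)
  interpret Z: v_group Z by fact
  interpret P: v_group "PB Z g" by (rule v_group_PB[OF assms(1) g])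
  have "w = \<one>\<^bsub>PB Z g\<^esub>" if w: "w \<in> sep_kernel (PB Z g)" for w
  proof -
    from w obtain y z where yz: "w = j (y, z)" "y \<in> carrier Y" "z \<in> carrier Z" "f y = g z"
      by (auto simp: sep_kernel_def elim: PB_cases)
    have "f \<one>\<^bsub>Y\<^esub> = \<one>\<^bsub>X\<^esub>" "g \<one>\<^bsub>Z\<^esub> = \<one>\<^bsub>X\<^esub>"
      using vhom_one[OF f_hom v_group_Y X] vhom_one[OF g assms(1) X] by auto
    then have "y \<in> sep_kernel Y" "z \<in> sep_kernel Z"
      using w yz by (auto simp: sep_kernel_def PB_one)
    then have "y = \<one>\<^bsub>Y\<^esub>"
      using separated_iff_sep_kernel[OF v_group_Y] separated_Y by auto
    then have "g z = \<one>\<^bsub>X\<^esub>" using yz \<open>f \<one>\<^bsub>Y\<^esub> = \<one>\<^bsub>X\<^esub>\<close> by simp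
    then have "z = \<one>\<^bsub>Z\<^esub>"
      by (rule covering_kernel[OF integral assms(2) \<open>z \<in> sep_kernel Z\<close>])
    then show ?thesis using yz \<open>y = \<one>\<^bsub>Y\<^esub>\<close> by (simp add: PB_one)
  qed
  moreover have "\<one>\<^bsub>PB Z g\<^esub> \<in> sep_kernel (PB Z g)"
    by (rule subgroup.one_closed[OF subgroup_sep_kernel]) unfold_locales
  ultimately have "sep_kernel (PB Z g) = {\<one>\<^bsub>PB Z g\<^esub>}" by blast
  then show ?thesis by (simp only: separated_iff_sep_kernel[OF P.v_group_axioms])
qed

text \<open>The effective descent morphism that witnesses the covering is \<open>f\<close> itself;
  this is where monadicity of \<open>Pb\<close> is used.\<close>

lemma covering_if_separated_PB:
  assumes "v_group Z" "g \<in> vhom Z X" "separated (PB Z g)"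
  shows "covering Z X g"
  unfolding covering_def
  using assms effective_descent_f is_pullback_PB[OF assms(1,2)]
    trivial_covering_if_separated[OF v_group_PB[OF assms(1,2)] v_group_Y assms(3) separated_Y
      p1_hom[OF assms(1,2)]]
  by blast

section \<open>Actions of the kernel pair of \<open>f\<close>\<close>

lemma Eq_pair_iff [simp]:
  "(y, y') \<in> carrier (Eq_pair Y f) \<longleftrightarrow> y \<in> carrier Y \<and> y' \<in> carrier Y \<and> f y = f y'"
  by (simp add: Eq_pair_def)

definition canonical_action :: "('u, 'v) vgroup \<Rightarrow> ('u \<Rightarrow> 'u) \<Rightarrow> ('u \<times> 'u) \<times> 'u \<Rightarrow> 'u" where
  "canonical_action Z g = (\<lambda>((y, y'), w) \<in> carrier (vg_pullback (Eq_pair Y f) fst (PB Z g) (p1 Z g)).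
     j (y', p2 Z g w))"

lemma canonical_action [simp]:
  "\<lbrakk>y \<in> carrier Y; y' \<in> carrier Y; f y = f y'; w \<in> carrier (PB Z g); p1 Z g w = y\<rbrakk>
    \<Longrightarrow> canonical_action Z g ((y, y'), w) = j (y', p2 Z g w)"
  by (simp add: canonical_action_def)

lemma Eq_action_canonical:
  assumes "v_group Z" "g \<in> vhom Z X"
  shows "Eq_action Y f (PB Z g) (p1 Z g) (canonical_action Z g)"
proof -
  let ?Q = "vg_pullback (Eq_pair Y f) fst (PB Z g) (p1 Z g)"
  interpret Z: v_group Z by fact
  interpret P: v_group "PB Z g" by (rule v_group_PB[OF assms])
  note [simp] = vhom_mult[OF f_hom] vhom_mult[OF p1_hom[OF assms]] vhom_mult[OF p2_hom[OF assms]]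
  have in_PB: "j (y', p2 Z g w) \<in> carrier (PB Z g)"
    if "w \<in> carrier (PB Z g)" "y' \<in> carrier Y" "f (p1 Z g w) = f y'" for y' w
    using that PB_commutes[OF that(1)] by simp
  have "canonical_action Z g \<in> vhom ?Q (PB Z g)"
  proof (rule vhomI)
    fix q q' assume "q \<in> carrier ?Q" "q' \<in> carrier ?Q"
    then obtain y y' w u u' v where q: "q = ((y, y'), w)" "q' = ((u, u'), v)"
      and *: "y' \<in> carrier Y" "u' \<in> carrier Y" "f y = f y'" "f u = f u'"
        "w \<in> carrier (PB Z g)" "v \<in> carrier (PB Z g)" "y = p1 Z g w" "u = p1 Z g v"
      by (cases q; cases q') auto
    have fg: "f y' = g (p2 Z g w)" "f u' = g (p2 Z g v)"
      using * PB_commutes[of w Z g] PB_commutes[of v Z g] by auto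
    show "canonical_action Z g (q \<otimes>\<^bsub>?Q\<^esub> q') =
        canonical_action Z g q \<otimes>\<^bsub>PB Z g\<^esub> canonical_action Z g q'"
      using * fg by (simp add: q Eq_pair_def)
    \<comment> \<open>The structure of \<open>?Q\<close> is a meet of three values: the one at
      \<open>y\<close> and \<open>u\<close> is discarded, and the one on the pullback is weakened
      along \<open>p2\<close>.\<close>
    have "rel ?Q q q' \<le> inf (rel Y y' u') (rel Z (p2 Z g w) (p2 Z g v))"
      using vhom_rel[OF p2_hom[OF assms] *(5,6)]
      by (auto simp: q Eq_pair_def intro: le_infI1 le_infI2 order_trans)
    then show "rel ?Q q q' \<le> rel (PB Z g) (canonical_action Z g q) (canonical_action Z g q')"
      using * fg by (simp add: q)
  qed (auto simp: canonical_action_def PB_commutes)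
  then show ?thesis
    unfolding Eq_action_def using P.v_group_axioms p1_hom[OF assms] in_PB
    by (auto simp: PB_commutes PB_p[symmetric])
qed

lemma category_Eq_actions: "category (Eq_actions Y f :: (_, 'u \<Rightarrow> 'u) cat)"
proof -
  let ?E = "Eq_actions Y f :: (('u, 'v) vgroup \<times> ('u \<Rightarrow> 'u) \<times> (('u \<times> 'u) \<times> 'u \<Rightarrow> 'u), 'u \<Rightarrow> 'u) cat"
  \<comment> \<open>Identities and composites are restricted to the carrier, so they can be
    evaluated at a value of \<xi> only once it is known to lie there.\<close>
  have closed: "\<xi> ((\<pi> t, y), t) \<in> carrier A"
    if "Eq_action Y f A \<pi> \<xi>" "t \<in> carrier A" "y \<in> carrier Y" "f (\<pi> t) = f y"
    for A :: "('u, 'v) vgroup" and \<pi> \<xi> t y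
  proof -
    have \<xi>: "\<xi> \<in> vhom (vg_pullback (Eq_pair Y f) fst A \<pi>) A" and \<pi>: "\<pi> \<in> vhom A Y"
      using that(1) by (auto simp: Eq_action_def)
    show ?thesis by (rule vhom_closed[OF \<xi>]) (use that vhom_closed[OF \<pi>] in auto)
  qed
  show ?thesis
  proof
    fix P assume P: "P \<in> Ob ?E"
    obtain A \<pi> \<xi> where [simp]: "P = (A, \<pi>, \<xi>)" by (metis surj_pair)
    have act: "Eq_action Y f A \<pi> \<xi>" using P by (simp add: Eq_actions_def)
    then interpret A: v_group A by (simp add: Eq_action_def)
    have "(\<lambda>t\<in>carrier A. t) \<in> vhom A A" by (rule vhomI) auto
    then show "Ident ?E P \<in> Hom ?E P P"
      by (auto simp: Eq_actions_def closed[OF act])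
  next
    fix P Q R p q
    assume *: "P \<in> Ob ?E" "Q \<in> Ob ?E" "R \<in> Ob ?E" "p \<in> Hom ?E P Q" "q \<in> Hom ?E Q R"
    obtain A \<pi> \<xi> where [simp]: "P = (A, \<pi>, \<xi>)" by (metis surj_pair)
    obtain A' \<pi>' \<xi>' where [simp]: "Q = (A', \<pi>', \<xi>')" by (metis surj_pair)
    obtain A'' \<pi>'' \<xi>'' where [simp]: "R = (A'', \<pi>'', \<xi>'')" by (metis surj_pair)
    have act: "Eq_action Y f A \<pi> \<xi>" using * by (simp add: Eq_actions_def)
    have p: "p \<in> vhom A A'" and q: "q \<in> vhom A' A''" using * by (auto simp: Eq_actions_def)
    have "compose (carrier A) q p \<in> vhom A A''"
      using p q act by (auto intro: vhom_compose simp: Eq_action_def)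
    moreover have q2: "q (\<xi>' ((\<pi>' u, y), u)) = \<xi>'' ((\<pi>' u, y), q u)"
      if "u \<in> carrier A'" "\<pi>' u \<in> carrier Y" "y \<in> carrier Y" "f (\<pi>' u) = f y" for u y
      using * that by (simp add: Eq_actions_def)
    have "q (\<xi>' ((\<pi> t, y), p t)) = \<xi>'' ((\<pi> t, y), q (p t))"
      if "t \<in> carrier A" "\<pi> t \<in> carrier Y" "y \<in> carrier Y" "f (\<pi> t) = f y" for t y
      using q2[of "p t" y] * that by (simp add: Eq_actions_def vhom_closed[OF p])
    ultimately show "Cmp ?E P Q R q p \<in> Hom ?E P R"
      using * by (auto simp: Eq_actions_def compose_eq closed[OF act] vhom_closed[OF p])
  next
    fix P Q p assume *: "P \<in> Ob ?E" "Q \<in> Ob ?E" "p \<in> Hom ?E P Q"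
    obtain A \<pi> \<xi> where [simp]: "P = (A, \<pi>, \<xi>)" by (metis surj_pair)
    obtain A' \<pi>' \<xi>' where [simp]: "Q = (A', \<pi>', \<xi>')" by (metis surj_pair)
    have p: "p \<in> vhom A A'" using * by (auto simp: Eq_actions_def)
    show "Cmp ?E P Q Q (Ident ?E Q) p = p"
      by (auto simp: Eq_actions_def vhom_closed[OF p] intro!: compose_eqI vhom_extensional[OF p])
    show "Cmp ?E P P Q p (Ident ?E P) = p"
      by (auto simp: Eq_actions_def intro!: compose_eqI vhom_extensional[OF p])
  next
    fix P Q R S p q r assume "R \<in> Ob ?E" "S \<in> Ob ?E" and *: "p \<in> Hom ?E P Q"
    obtain A \<pi> \<xi> where [simp]: "P = (A, \<pi>, \<xi>)" by (metis surj_pair)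
    obtain A' \<pi>' \<xi>' where [simp]: "Q = (A', \<pi>', \<xi>')" by (metis surj_pair)
    obtain A'' \<pi>'' \<xi>'' where [simp]: "R = (A'', \<pi>'', \<xi>'')" by (metis surj_pair)
    obtain A3 \<pi>3 \<xi>3 where [simp]: "S = (A3, \<pi>3, \<xi>3)" by (metis surj_pair)
    have p: "p \<in> vhom A A'" using * by (auto simp: Eq_actions_def)
    show "Cmp ?E P R S r (Cmp ?E P Q R q p) = Cmp ?E P Q S (Cmp ?E Q R S r q) p"
      by (auto simp: Eq_actions_def compose_eq vhom_closed[OF p] intro!: compose_cong)
  qed
qed

section \<open>The equivalence between coverings and separated actions\<close>

definition covering_to_action :: "(('u, 'v) vgroup \<times> ('u \<Rightarrow> 'u), 'u \<Rightarrow> 'u,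
    ('u, 'v) vgroup \<times> ('u \<Rightarrow> 'u) \<times> (('u \<times> 'u) \<times> 'u \<Rightarrow> 'u), 'u \<Rightarrow> 'u) fctr" where
  "covering_to_action = \<lparr>Fo = (\<lambda>(Z, g). (PB Z g, p1 Z g, canonical_action Z g)),
     Fm = (\<lambda>(Z, g) _ h. Pbm Z g h)\<rparr>"

lemma covering_to_action_simps [simp]:
  "Fo covering_to_action (Z, g) = (PB Z g, p1 Z g, canonical_action Z g)"
  "Fm covering_to_action (Z, g) A h = Pbm Z g h"
  by (simp_all add: covering_to_action_def)

lemma coverings_over_simps [simp]:
  "(Z, g) \<in> Ob (coverings_over X) \<longleftrightarrow> v_group Z \<and> g \<in> vhom Z X \<and> covering Z X g"
  "Hom (coverings_over X) = Hom (slice VGrp X)"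
  "Ident (coverings_over X) = Ident (slice VGrp X)"
  "Cmp (coverings_over X) = Cmp (slice VGrp X)"
  by (auto simp: coverings_over_def full_sub_def)

lemma sep_Eq_actions_simps [simp]:
  "(A, \<pi>, \<xi>) \<in> Ob (sep_Eq_actions Y f) \<longleftrightarrow> Eq_action Y f A \<pi> \<xi> \<and> separated A"
  "\<phi> \<in> Hom (sep_Eq_actions Y f) (A, \<pi>, \<xi>) (A', \<pi>', \<xi>') \<longleftrightarrow> \<phi> \<in> vhom A A' \<and>
     (\<forall>t\<in>carrier A. \<pi>' (\<phi> t) = \<pi> t) \<and>
     (\<forall>y t. y \<in> carrier Y \<and> t \<in> carrier A \<and> \<pi> t \<in> carrier Y \<and> f (\<pi> t) = f y \<longrightarrow>
        \<phi> (\<xi> ((\<pi> t, y), t)) = \<xi>' ((\<pi> t, y), \<phi> t))"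
  "Ident (sep_Eq_actions Y f) (A, \<pi>, \<xi>) = (\<lambda>t\<in>carrier A. t)"
  "Cmp (sep_Eq_actions Y f) (A, \<pi>, \<xi>) (A', \<pi>', \<xi>') (A'', \<pi>'', \<xi>'') k h = compose (carrier A) k h"
  by (auto simp: sep_Eq_actions_def full_sub_def Eq_actions_def)

lemma cat_functor_covering_to_action:
  "cat_functor (coverings_over X) (sep_Eq_actions Y f) covering_to_action"
proof -
  interpret C: category "coverings_over X"
    unfolding coverings_over_def by (rule category_full_sub) unfold_locales
  interpret S: category "sep_Eq_actions Y f :: (_, 'u \<Rightarrow> 'u) cat"
    unfolding sep_Eq_actions_def by (rule category_full_sub[OF category_Eq_actions])
  show ?thesis
  proof unfold_locales
    fix P :: "('u, 'v) vgroup \<times> ('u \<Rightarrow> 'u)" assume P: "P \<in> Ob (coverings_over X)"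
    then show "Fo covering_to_action P \<in> Ob (sep_Eq_actions Y f)"
      by (cases P) (simp add: Eq_action_canonical separated_PB_if_covering)
    show "Fm covering_to_action P P (Ident (coverings_over X) P) =
        Ident (sep_Eq_actions Y f) (Fo covering_to_action P)"
      by (cases P) (simp add: Pbm_Ident)
  next
    fix P Q h assume *: "P \<in> Ob (coverings_over X)" "Q \<in> Ob (coverings_over X)"
      "h \<in> Hom (coverings_over X) P Q"
    obtain Z g where P: "P = (Z, g)" by (cases P)
    obtain Z' g' where Q: "Q = (Z', g')" by (cases Q)
    have Z: "v_group Z" "g \<in> vhom Z X" and h: "h \<in> vhom Z Z'" "compose (carrier Z) g' h = g"
      using * by (auto simp: P Q)
    have k: "Pbm Z g h \<in> vhom (PB Z g) (PB Z' g')" by (rule Pbm_hom[OF Z h])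
    have p1: "p1 Z' g' (Pbm Z g h w) = p1 Z g w" if "w \<in> carrier (PB Z g)" for w
      by (rule compose_eqD[OF p1_Pbm[OF h] that])
    have "Pbm Z g h (j (y, p2 Z g w)) = j (y, p2 Z' g' (Pbm Z g h w))"
      if "w \<in> carrier (PB Z g)" "y \<in> carrier Y" "f (p1 Z g w) = f y" for w y
      using that compose_eqD[OF h(2)] by (auto simp: vhom_closed[OF h(1)] elim!: PB_cases)
    then show "Fm covering_to_action P Q h \<in>
        Hom (sep_Eq_actions Y f) (Fo covering_to_action P) (Fo covering_to_action Q)"
      using k by (simp add: P Q p1 vhom_closed[OF k])
  next
    fix P Q R h k assume "P \<in> Ob (coverings_over X)" "Q \<in> Ob (coverings_over X)"
      "R \<in> Ob (coverings_over X)" "h \<in> Hom (coverings_over X) P Q" "k \<in> Hom (coverings_over X) Q R"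
    then show "Fm covering_to_action P R (Cmp (coverings_over X) P Q R k h) =
        Cmp (sep_Eq_actions Y f) (Fo covering_to_action P) (Fo covering_to_action Q)
          (Fo covering_to_action R) (Fm covering_to_action Q R k) (Fm covering_to_action P Q h)"
      by (cases P; cases Q; cases R) (auto intro: Pbm_compose)
  qed
qed

lemma equivalence_covering_to_action:
  "is_equivalence (coverings_over X) (sep_Eq_actions Y f) covering_to_action"
proof (rule is_equivalence_if_fully_faithful_ess_surj[OF cat_functor_covering_to_action])
  fix P Q :: "('u, 'v) vgroup \<times> ('u \<Rightarrow> 'u)" and k
  assume PQ: "P \<in> Ob (coverings_over X)" "Q \<in> Ob (coverings_over X)"
    "k \<in> Hom (sep_Eq_actions Y f) (Fo covering_to_action P) (Fo covering_to_action Q)"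
  obtain Z g where P: "P = (Z, g)" by (cases P)
  obtain Z' g' where Q: "Q = (Z', g')" by (cases Q)
  have Z: "v_group Z" "g \<in> vhom Z X" "v_group Z'" "g' \<in> vhom Z' X"
    and k: "k \<in> vhom (PB Z g) (PB Z' g')"
    and k1: "\<And>w. w \<in> carrier (PB Z g) \<Longrightarrow> p1 Z' g' (k w) = p1 Z g w"
    and k2: "\<And>y w. \<lbrakk>y \<in> carrier Y; w \<in> carrier (PB Z g); f (p1 Z g w) = f y\<rbrakk> \<Longrightarrow>
      k (canonical_action Z g ((p1 Z g w, y), w)) = canonical_action Z' g' ((p1 Z g w, y), k w)"
    using PQ by (auto simp: P Q)
  have "\<exists>!h. (h \<in> vhom Z Z' \<and> compose (carrier Z) g' h = g) \<and> Pbm Z g h = k"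
  proof (rule ex1_Pbm[OF Z k k1])
    fix y y' z assume *: "y \<in> carrier Y" "y' \<in> carrier Y" "z \<in> carrier Z" "f y = g z" "f y' = g z"
    have w: "j (y', z) \<in> carrier (PB Z g)" using * by simp
    let ?w = "k (j (y', z))"
    have kw: "?w \<in> carrier (PB Z' g')" by (rule vhom_closed[OF k w])
    have p: "p1 Z' g' ?w = y'" using k1[OF w] * by simp
    \<comment> \<open>The canonical action moves (y', z) to (y, z), so equivariance of
      \<open>k\<close> compares its values at these two points.\<close>
    have "k (j (y, z)) = j (y, p2 Z' g' ?w)"
      using k2[OF *(1) w] * kw p by simp
    moreover have "f y = g' (p2 Z' g' ?w)" using PB_commutes[OF kw] p * by simp
    ultimately show "p2 Z' g' (k (j (y, z))) = p2 Z' g' ?w" using * kw by simp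
  qed
  then show "\<exists>!h. h \<in> Hom (coverings_over X) P Q \<and> Fm covering_to_action P Q h = k"
    by (simp add: P Q)
next
  fix E :: "('u, 'v) vgroup \<times> ('u \<Rightarrow> 'u) \<times> (('u \<times> 'u) \<times> 'u \<Rightarrow> 'u)"
  assume E: "E \<in> Ob (sep_Eq_actions Y f)"
  obtain A \<pi> \<xi> where E_eq: "E = (A, \<pi>, \<xi>)" by (metis surj_pair)
  let ?Q = "vg_pullback (Eq_pair Y f) fst A \<pi>"
  have act: "Eq_action Y f A \<pi> \<xi>" and sep: "separated A" using E by (auto simp: E_eq)
  then have A: "v_group A" and \<pi>: "\<pi> \<in> vhom A Y" and \<xi>: "\<xi> \<in> vhom ?Q A"
    by (auto simp: Eq_action_def)
  interpret A: v_group A by (rule A)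
  note [simp] = vhom_closed[OF \<pi>]
  have \<pi>\<xi>: "\<pi> (\<xi> ((\<pi> t, y), t)) = y" if "y \<in> carrier Y" "t \<in> carrier A" "f y = f (\<pi> t)" for y t
    using act that by (simp add: Eq_action_def)
  interpret E: eq_action X Y e f j A \<pi> "\<lambda>y t. \<xi> ((\<pi> t, y), t)"
  proof
    fix y t assume yt: "y \<in> carrier Y" "t \<in> carrier A" "f y = f (\<pi> t)"
    then show \<xi>_in: "\<xi> ((\<pi> t, y), t) \<in> carrier A" by (intro vhom_closed[OF \<xi>]) simp
    show "\<pi> (\<xi> ((\<pi> t, y), t)) = y" by (rule \<pi>\<xi>[OF yt])
    show "\<xi> ((\<pi> (\<xi> ((\<pi> t, y), t)), y'), \<xi> ((\<pi> t, y), t)) = \<xi> ((\<pi> t, y'), t)"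
      if "y' \<in> carrier Y" "f y' = f (\<pi> t)" for y'
      unfolding \<pi>\<xi>[OF yt] using act yt that by (simp add: Eq_action_def)
    fix y' t' assume yt': "y' \<in> carrier Y" "t' \<in> carrier A" "f y' = f (\<pi> t')"
    have in_Q: "((\<pi> t, y), t) \<in> carrier ?Q" "((\<pi> t', y'), t') \<in> carrier ?Q"
      using yt yt' by simp_all
    show "\<xi> ((\<pi> (t \<otimes>\<^bsub>A\<^esub> t'), y \<otimes>\<^bsub>Y\<^esub> y'), t \<otimes>\<^bsub>A\<^esub> t') = \<xi> ((\<pi> t, y), t) \<otimes>\<^bsub>A\<^esub> \<xi> ((\<pi> t', y'), t')"
      using vhom_mult[OF \<xi> in_Q] vhom_mult[OF \<pi>] yt yt' by (simp add: Eq_pair_def)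
    \<comment> \<open>The structure of \<open>?Q\<close> contains the further value
      \<open>rel Y (\<pi> t) (\<pi> t')\<close>, which is absorbed because it lies above
      \<open>rel A t t'\<close>.\<close>
    have "inf (rel Y y y') (rel A t t') = rel ?Q ((\<pi> t, y), t) ((\<pi> t', y'), t')"
      using vhom_rel[OF \<pi> yt(2) yt'(2)]
      by (simp add: Eq_pair_def inf.absorb2 inf.assoc inf.left_commute[of _ "rel Y y y'"])
    then show "inf (rel Y y y') (rel A t t') \<le> rel A (\<xi> ((\<pi> t, y), t)) (\<xi> ((\<pi> t', y'), t'))"
      using vhom_rel[OF \<xi> in_Q] by simp
  next
    fix t assume "t \<in> carrier A"
    then show "\<xi> ((\<pi> t, \<pi> t), t) = t" using act by (simp add: Eq_action_def)
  qed (use A \<pi> in auto)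
  let ?Z = E.Z and ?g = E.g
  let ?P = "PB ?Z ?g"
  note [simp] = vhom_closed[OF E.\<phi>_hom] vhom_closed[OF E.\<psi>_hom]
  \<comment> \<open>\<open>E.\<phi>\<close> is an injective V-homomorphism into the separated
    \<open>A\<close>, and separatedness is reflected along such maps.\<close>
  have "separated ?P"
    unfolding separated_def
  proof (intro ballI impI)
    fix w w' assume w: "w \<in> carrier ?P" "w' \<in> carrier ?P" "1 \<le> rel ?P w w' \<and> 1 \<le> rel ?P w' w"
    then have "1 \<le> rel A (E.\<phi> w) (E.\<phi> w')" "1 \<le> rel A (E.\<phi> w') (E.\<phi> w)"
      using vhom_rel[OF E.\<phi>_hom w(1,2)] vhom_rel[OF E.\<phi>_hom w(2,1)] by (auto intro: order_trans)
    then have "E.\<phi> w = E.\<phi> w'" using sep w by (auto simp: separated_def)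
    from arg_cong[OF this, of E.\<psi>] show "w = w'" using w(1,2) by simp
  qed
  then have cov: "(?Z, ?g) \<in> Ob (coverings_over X)"
    using E.v_group_Z E.g_hom by (simp add: covering_if_separated_PB)
  have "E.\<phi> \<in> Hom (sep_Eq_actions Y f) (Fo covering_to_action (?Z, ?g)) E"
    by (auto simp: E_eq E.\<phi>_hom E.\<pi>_\<phi> E.\<phi>_equivariant simp del: E.f_\<pi>)
  moreover have "E.\<psi> \<in> Hom (sep_Eq_actions Y f) E (Fo covering_to_action (?Z, ?g))"
    by (auto simp: E_eq E.\<psi>_hom E.p1_\<psi> E.\<psi>_equivariant)
  moreover have "compose (carrier ?P) E.\<psi> E.\<phi> = (\<lambda>w\<in>carrier ?P. w)"
    by (rule compose_eqI) auto
  moreover have "compose (carrier A) E.\<phi> E.\<psi> = (\<lambda>t\<in>carrier A. t)"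
    by (rule compose_eqI) auto
  ultimately have "is_iso (sep_Eq_actions Y f) (Fo covering_to_action (?Z, ?g)) E E.\<phi>"
    unfolding is_iso_def E_eq by (auto intro!: bexI[of _ E.\<psi>])
  with cov show "\<exists>P\<in>Ob (coverings_over X). \<exists>\<phi>. is_iso (sep_Eq_actions Y f) (Fo covering_to_action P) E \<phi>"
    by blast
qed

end

section \<open>Coding pairs in the universe, and the conclusion\<close>

lemma ex_inj_pair:
  assumes "infinite (UNIV :: 'u set)"
  shows "\<exists>j :: 'u \<times> 'u \<Rightarrow> 'u. inj j"
proof -
  obtain j :: "'u \<times> 'u \<Rightarrow> 'u" where "bij_betw j (UNIV \<times> UNIV) UNIV"
    using card_of_Times_same_infinite[OF assms] card_of_ordIso by blast
  then show ?thesis by (auto simp: bij_betw_def)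
qed

theorem theorem4p4:
  fixes X Y :: "('u, 'v::comm_quantale) vgroup"
    and e :: "int \<times> 'u \<Rightarrow> 'u"
    and f :: "'u \<Rightarrow> 'u"
  assumes integral: "(1::'v) = Orderings.top"
    and nontrivial: "(bot::'v) \<noteq> Orderings.top"
    and frame: "\<And>(v::'v) A. inf v (Sup A) = (SUP w\<in>A. inf v w)"
    and X: "v_group X"
    and e: "inj_on e (carrier (int_ext X))"
    and Y: "Y = vg_copy e (int_ext X)"
    and f: "f \<in> extensional (carrier Y)"
      "\<And>z x. x \<in> carrier X \<Longrightarrow> f (e (z, x)) = x"
  shows "effective_descent VGrp Y X f \<and>
    equivalent_categories (coverings_over X) (sep_Eq_actions Y f :: (_, 'u \<Rightarrow> 'u) cat)"
proof -
  interpret X: v_group X by (rule X)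
  \<comment> \<open>The carrier of X is non-empty, so its product with the integers is infinite; its
    copy under \<open>e\<close> makes the universe infinite, which provides the code
    \<open>j\<close> for pairs.\<close>
  have "infinite (carrier (int_ext X))"
    using X.one_closed by (auto simp: finite_cartesian_product_iff infinite_UNIV_char_0)
  then have "infinite (UNIV :: 'u set)"
    using e by (meson finite_imageD finite_subset subset_UNIV)
  then obtain j :: "'u \<times> 'u \<Rightarrow> 'u" where "inj j"
    using ex_inj_pair by blast
  then interpret int_cover X Y e f j
    using assms by unfold_locales auto
  show ?thesis
    unfolding equivalent_categories_def
    using effective_descent_f equivalence_covering_to_action by blast
qed

end
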